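(* Let $n\ge1$ and let $f:\mathbb R^n\to\mathbb R$ be a continuous function which has continuous derivatives, such that, for all $x\in\mathbb R^n$, $w\in S_n$, $r\in\mathbb Z^n$ and $i=1,\dots,n$, $$f(wx+r)=f(x),\qquad f(\varepsilon_ix)=f(x).$$ Then $f$ (considered as a function on $F$) can be expanded as $$f(x)=\sum_{m\in P_+}c_m\,\cos^+_m(x),$$ where the coefficients are given by $$c_m=2^{2n}\,|G_m|^{-1}\int_{\overline F}f(x)\,\cos^+_m(x)\,dx .$$ The Plancherel formula is $$\sum_{m\in P_+}|G_m|\,|c_m|^2=2^{2n}\int_{\overline F}|f(x)|^2dx .$$
   Context: The symmetric group $S_n$ acts on $\mathbb R^n$ by permuting coordinates and $\varepsilon_i$ changes the sign of the coordinate $x_i$. $F=\{x\in\mathbb R^n:\tfrac12>x_1>x_2>\cdots>x_n>0\}$ with closure $\overline F$. $P_+=\{m\in\mathbb Z^n: m_1\ge m_2\ge\cdots\ge m_n\ge0\}$. $G_m\subset S_n$ is the subgroup of permutations leaving the $n$-tuple $m$ invariant and $|G_m|$ is its order. $\cos^+_m(x)=\sum_{w\in S_n}\prod_{j=1}^n\cos(2\pi m_{w(j)}x_j)$.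
   Formalization: As printed the formulas fail for m with zero entries (n=1, f=1 gives c_0=2); |G_m| is replaced by 2^{z(m)}|G_m|, z(m) the number of zero entries of m, in both formulas; the expansion is the pointwise limit on F of sums over m in P_+ with all m_i ≤ N. *)

theory Defs
  imports "HOL-Analysis.Analysis"
begin

text \<open>The index set \<open>{1,\<dots>,n}\<close> is an arbitrary nonempty finite linear order \<open>'n\<close>,
  so that \<open>n = CARD('n) \<ge> 1\<close>; the order is needed for the chains \<open>x\<^sub>1 > \<dots> > x\<^sub>n\<close>.\<close>

definition perm_vec :: "('n \<Rightarrow> 'n) \<Rightarrow> 'a ^ 'n \<Rightarrow> 'a ^ ('n::finite)" where
  "perm_vec w x = (\<chi> i. x $ w i)"

definition sign_flip :: "'n \<Rightarrow> real ^ 'n \<Rightarrow> real ^ ('n::finite)" where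
  "sign_flip i x = (\<chi> j. if j = i then - (x $ j) else x $ j)"

definition int_vec :: "int ^ 'n \<Rightarrow> real ^ ('n::finite)" where
  "int_vec r = (\<chi> i. real_of_int (r $ i))"

definition fundF :: "(real ^ ('n::{finite,linorder})) set" where
  "fundF = {x. (\<forall>i. 0 < x $ i \<and> x $ i < 1/2) \<and> (\<forall>i j. i < j \<longrightarrow> x $ i > x $ j)}"

definition P_plus :: "(int ^ ('n::{finite,linorder})) set" where
  "P_plus = {m. (\<forall>i j. i \<le> j \<longrightarrow> m $ i \<ge> m $ j) \<and> (\<forall>i. m $ i \<ge> 0)}"

definition stabG :: "int ^ 'n \<Rightarrow> ('n::finite \<Rightarrow> 'n) set" where
  "stabG m = {w. w permutes UNIV \<and> perm_vec w m = m}"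

definition cos_plus :: "int ^ 'n \<Rightarrow> real ^ ('n::finite) \<Rightarrow> real" where
  "cos_plus m x = (\<Sum>w | w permutes UNIV. \<Prod>j\<in>UNIV. cos (2 * pi * real_of_int (m $ w j) * x $ j))"

text \<open>The integral of \<open>(cos_plus m)\<^sup>2\<close> over the closure of \<open>fundF\<close> is
  \<open>2 ^ zeros m * card (stabG m) / 2 ^ (2 * n)\<close>: over \<open>[0, 1/2]\<close>, the square of
  \<open>cos (2 * pi * k * t)\<close> has integral \<open>1/4\<close> for \<open>k \<noteq> 0\<close> but \<open>1/2\<close> for \<open>k = 0\<close>.
  Equivalently, \<open>2 ^ zeros m * card (stabG m)\<close> is the order of the stabilizer of \<open>m\<close> in the
  group generated by all permutations and sign changes of coordinates.\<close>

definition zeros :: "int ^ ('n::finite) \<Rightarrow> nat" where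
  "zeros m = card {i. m $ i = 0}"

definition continuous_partials :: "(real ^ ('n::finite) \<Rightarrow> real) \<Rightarrow> bool" where
  "continuous_partials f \<longleftrightarrow>
     (\<forall>i. \<exists>g. continuous_on UNIV g \<and>
        (\<forall>x. ((\<lambda>t. f (x + t *\<^sub>R axis i 1)) has_real_derivative g x) (at 0)))"

text \<open>The order of summation for expansions over \<open>P_plus\<close>. For merely continuously
  differentiable functions of three or more variables the expansion need not converge
  absolutely, so its sum is the limit of these partial sums.\<close>

definition P_plus_upto :: "nat \<Rightarrow> (int ^ ('n::{finite,linorder})) set" where
  "P_plus_upto N = {m \<in> P_plus. \<forall>i. m $ i \<le> int N}"

end

(* On [0,1/2] the N-th cosine partial sum in one variable is integration against
   D_N(x-t) + D_N(x+t), with D_N the Dirichlet kernel. Its L^1 norm is O(log N). Since D_N is minus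
   the derivative of K_N(s) = 1/2 - s - sum_{k<=N} sin(2 pi k s)/(pi k), whose L^2 norm on [0,1] is
   O(N^(-1/2)) by the Basel sum, integrating by parts on both sides of x shows that the partial sums
   of a C^1 function with derivative bounded by B differ from it by at most 3B/sqrt N. In n variables
   the cubic partial sum is a product of these operators, so replacing one coordinate at a time gives
   a uniform error O(N^(-1/2) (log N)^(n-1)). The sum over the cube {0..N}^n folds to the dominant
   weights by grouping permutation orbits, and [0,1/2]^n is, up to a null set, the union of the n!
   permuted copies of F. Plancherel follows by integrating f against its uniformly convergent
   partial sums. *)

theory Submission
  imports Defs "HOL-Real_Asymp.Real_Asymp"
begin

section \<open>The Dirichlet kernel\<close>

text \<open>The obstacle is that only first partial derivatives are available: one can integrate by
  parts in one coordinate at a time, and the coefficients need not be absolutely summable. Replacing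
  a coordinate gains one factor \<open>N^(-1/2)\<close>, while every coordinate replaced before it
  costs one L^1 norm of the kernel; the method works because a fixed power of a logarithm loses
  against \<open>sqrt N\<close>. The gain comes from \<open>K_N\<close> being the remainder of the
  Fourier series of the sawtooth \<open>1/2 - s\<close>: its L^1 norm is small although its value at
  \<open>0\<close> is always \<open>1/2\<close>, and that value reproduces \<open>f(x)\<close> as a
  jump at \<open>t = x\<close>. The factor \<open>2 ^ zeros m\<close> has its source in one
  variable: the constant term of \<open>D_N(x-t) + D_N(x+t)\<close> is 2, whereas the other terms
  carry the factor 4. The Plancherel series has nonnegative terms, so convergence along cubes
  already makes it an unordered sum, a stronger conclusion than the one for the expansion.\<close>

definition dirichlet :: "nat \<Rightarrow> real \<Rightarrow> real" where
  "dirichlet N s = 1 + 2 * (\<Sum>k=1..N. cos (2 * pi * real k * s))"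

text \<open>The remainder after \<open>N\<close> terms of the sine series of the sawtooth
  \<open>1/2 - s\<close> on (0,1). It is not periodic, so the proofs keep its argument inside [0,1],
  where it is small in the mean.\<close>

definition dirichlet_primitive :: "nat \<Rightarrow> real \<Rightarrow> real" where
  "dirichlet_primitive N s = 1/2 - s - (\<Sum>k=1..N. sin (2 * pi * real k * s) / (pi * real k))"

lemma continuous_on_dirichlet [continuous_intros]:
  fixes g :: "real \<Rightarrow> real"
  shows "continuous_on S g \<Longrightarrow> continuous_on S (\<lambda>x. dirichlet N (g x))"
  unfolding dirichlet_def by (auto intro!: continuous_intros)

lemma continuous_on_dirichlet_primitive [continuous_intros]:
  fixes g :: "real \<Rightarrow> real"
  shows "continuous_on S g \<Longrightarrow> continuous_on S (\<lambda>x. dirichlet_primitive N (g x))"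
  unfolding dirichlet_primitive_def
  by (auto intro!: continuous_intros)

lemma has_derivative_dirichlet_primitive:
  "(dirichlet_primitive N has_real_derivative - dirichlet N s) (at s)"
proof -
  have "((\<lambda>s. \<Sum>k=1..N. sin (2 * pi * real k * s) / (pi * real k)) has_real_derivative
      (\<Sum>k=1..N. 2 * cos (2 * pi * real k * s))) (at s)"
    by (intro DERIV_sum) (auto intro!: derivative_eq_intros)
  then have "((\<lambda>s. 1/2 - s - (\<Sum>k=1..N. sin (2 * pi * real k * s) / (pi * real k))) has_real_derivative
      0 - 1 - (\<Sum>k=1..N. 2 * cos (2 * pi * real k * s))) (at s)"
    by (intro DERIV_diff DERIV_const DERIV_ident)
  then show ?thesis
    by (simp add: dirichlet_def dirichlet_primitive_def[abs_def] sum_distrib_left)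
qed

lemma cos_period_int: "cos (2 * pi * real k * (s + 1)) = cos (2 * pi * real k * s)"
proof -
  have "cos (2 * pi * real k * s + 2 * real k * pi) = cos (2 * pi * real k * s)"
    by (simp add: cos_add)
  then show ?thesis by (simp add: algebra_simps)
qed

lemma sin_period_int: "sin (2 * pi * real k * (1 - s)) = - sin (2 * pi * real k * s)"
proof -
  have "sin (2 * real k * pi - 2 * pi * real k * s) = - sin (2 * pi * real k * s)"
    by (simp add: sin_diff)
  then show ?thesis by (simp add: algebra_simps)
qed

lemma dirichlet_minus [simp]: "dirichlet N (- s) = dirichlet N s"
  by (simp add: dirichlet_def)

lemma dirichlet_periodic [simp]: "dirichlet N (s + 1) = dirichlet N s"
  by (simp add: dirichlet_def cos_period_int)

text \<open>Both the sawtooth and each sine change sign under the reflection at \<open>1/2\<close>.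
  This cancels the boundary term at \<open>t = 1/2\<close> in
  \<open>cos_kernel_approximates\<close>.\<close>

lemma dirichlet_primitive_reflect: "dirichlet_primitive N (1 - s) = - dirichlet_primitive N s"
  by (simp add: dirichlet_primitive_def sin_period_int sum_negf)

lemma dirichlet_primitive_0: "dirichlet_primitive N 0 = 1/2"
  by (simp add: dirichlet_primitive_def)

text \<open>The sum telescopes through 2 sin a cos u = sin(u+a) - sin(u-a) with
  \<open>a = pi * s\<close>. The product form avoids dividing by a sine that may vanish.\<close>

lemma sin_mult_dirichlet: "sin (pi * s) * dirichlet N s = sin ((2 * real N + 1) * pi * s)"
proof (induction N)
  case 0
  then show ?case by (simp add: dirichlet_def)
next
  case (Suc N)
  define u where "u = 2 * pi * real (Suc N) * s"
  have "sin (pi * s) * dirichlet (Suc N) s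
      = sin (pi * s) * dirichlet N s + 2 * sin (pi * s) * cos u"
    by (simp add: dirichlet_def u_def algebra_simps)
  also have "\<dots> = sin (u - pi * s) + 2 * sin (pi * s) * cos u"
    unfolding Suc.IH by (simp add: u_def algebra_simps)
  also have "\<dots> = sin (u + pi * s)"
    by (simp add: sin_add sin_diff)
  also have "\<dots> = sin ((2 * real (Suc N) + 1) * pi * s)"
    by (simp add: u_def algebra_simps)
  finally show ?case .
qed

text \<open>Concavity puts sine above its chord from 0 to \<open>pi/2\<close>, and
  \<open>2 * s\<close> is the position of \<open>pi * s\<close> on that chord (Jordan's
  inequality).\<close>

lemma sin_pi_ge:
  assumes "0 \<le> s" "s \<le> 1/2"
  shows "2 * s \<le> sin (pi * s)"
proof -
  have "concave_on {0..pi} sin"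
    by (rule f''_le0_imp_concave[where f' = cos and f'' = "\<lambda>x. - sin x"])
      (auto intro!: derivative_eq_intros sin_ge_zero)
  then have "convex_on {0..pi} (\<lambda>x. - sin x)"
    by (simp add: concave_on_def)
  from convex_onD[OF this, of "2 * s" 0 "pi/2"] assms show ?thesis
    by (auto simp: mult_ac)
qed

section \<open>Logarithmic L^1 bounds for the Dirichlet kernel\<close>

lemma abs_dirichlet_le_card: "\<bar>dirichlet N s\<bar> \<le> 2 * real N + 1"
proof -
  have "\<bar>\<Sum>k=1..N. cos (2 * pi * real k * s)\<bar> \<le> (\<Sum>k=1..N. 1)"
    by (rule order_trans[OF sum_abs]) (intro sum_mono, simp)
  then show ?thesis by (auto simp: dirichlet_def)
qed

text \<open>With \<open>a = 2 * real N + 1\<close>, the two bounds |D| \<le> a and 2s|D| \<le> 1 are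
  merged by adding the first to \<open>a\<close> times the second. The resulting rational majorant
  integrates to a logarithm without splitting the interval near 0.\<close>

lemma abs_dirichlet_le:
  assumes "0 \<le> s" "s \<le> 1/2"
  shows "\<bar>dirichlet N s\<bar> \<le> 2 * (2 * real N + 1) / (1 + 2 * (2 * real N + 1) * s)"
proof -
  define a where "a = 2 * real N + 1"
  have a: "a > 0" by (simp add: a_def)
  have "2 * s * \<bar>dirichlet N s\<bar> \<le> \<bar>sin (pi * s)\<bar> * \<bar>dirichlet N s\<bar>"
    using sin_pi_ge[OF assms] assms by (intro mult_right_mono) auto
  also have "\<dots> \<le> 1"
    by (subst abs_mult[symmetric], subst sin_mult_dirichlet) simp
  finally have 1: "2 * s * \<bar>dirichlet N s\<bar> \<le> 1" .
  have 2: "\<bar>dirichlet N s\<bar> \<le> a"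
    using abs_dirichlet_le_card[of N s] by (simp add: a_def)
  have "a * (2 * s * \<bar>dirichlet N s\<bar>) \<le> a * 1"
    using 1 a by (intro mult_left_mono) auto
  then have "\<bar>dirichlet N s\<bar> * (1 + 2 * a * s) \<le> 2 * a"
    using 2 by (simp add: algebra_simps)
  moreover have "1 + 2 * a * s > 0" using a assms by (simp add: add_pos_nonneg)
  ultimately show ?thesis unfolding a_def[symmetric] by (simp add: field_simps)
qed

lemma integral_abs_dirichlet_half: "integral {0..1/2} (\<lambda>s. \<bar>dirichlet N s\<bar>) \<le> ln (2 * real N + 2)"
proof -
  define a where "a = 2 * real N + 1"
  have a: "a > 0" by (simp add: a_def)
  have pos: "1 + 2 * a * s > 0" if "s \<ge> 0" for s using a that by (simp add: add_pos_nonneg)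
  have *: "((\<lambda>s. 2 * a / (1 + 2 * a * s)) has_integral ln (1 + 2 * a * (1/2)) - ln (1 + 2 * a * 0)) {0..1/2}"
    by (rule fundamental_theorem_of_calculus)
      (auto simp: has_real_derivative_iff_has_vector_derivative[symmetric] pos
        intro!: derivative_eq_intros)
  have "integral {0..1/2} (\<lambda>s. \<bar>dirichlet N s\<bar>) \<le> integral {0..1/2} (\<lambda>s. 2 * a / (1 + 2 * a * s))"
  proof (rule integral_le)
    show "(\<lambda>s. \<bar>dirichlet N s\<bar>) integrable_on {0..1/2}"
      by (intro integrable_continuous_real continuous_intros)
    show "(\<lambda>s. 2 * a / (1 + 2 * a * s)) integrable_on {0..1/2}"
      using * by blast
  qed (use abs_dirichlet_le[of _ N] in \<open>auto simp: a_def\<close>)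
  also have "\<dots> = ln (2 * real N + 2)"
    using integral_unique[OF *] by (simp add: a_def algebra_simps)
  finally show ?thesis .
qed

text \<open>For x and t in [0,1/2], the difference x - t ranges in [-1/2,1/2] and the sum x + t in
  [0,1]. These are the two windows on which \<open>integral_abs_cos_kernel\<close> needs the L^1
  norm.\<close>

lemma integral_abs_dirichlet_symmetric:
  "integral {-1/2..1/2} (\<lambda>s. \<bar>dirichlet N s\<bar>) \<le> 2 * ln (2 * real N + 2)"
proof -
  have "integral {-1/2..0} (\<lambda>s. \<bar>dirichlet N s\<bar>) = integral {0..1/2} (\<lambda>s. \<bar>dirichlet N s\<bar>)"
    using Henstock_Kurzweil_Integration.integral_reflect_real[of "1/2" 0 "\<lambda>s. \<bar>dirichlet N s\<bar>"] by simp
  moreover have "integral {-1/2..0} (\<lambda>s. \<bar>dirichlet N s\<bar>) + integral {0..1/2} (\<lambda>s. \<bar>dirichlet N s\<bar>)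
      = integral {-1/2..1/2} (\<lambda>s. \<bar>dirichlet N s\<bar>)"
    by (intro Henstock_Kurzweil_Integration.integral_combine integrable_continuous_real continuous_intros) auto
  ultimately show ?thesis using integral_abs_dirichlet_half[of N] by simp
qed

lemma integral_abs_dirichlet_unit:
  "integral {0..1} (\<lambda>s. \<bar>dirichlet N s\<bar>) \<le> 2 * ln (2 * real N + 2)"
proof -
  have "integral {1/2..1} (\<lambda>s. \<bar>dirichlet N s\<bar>) = integral {-1/2..0} (\<lambda>s. \<bar>dirichlet N s\<bar>)"
    using integral_shift_real_ivl[of "1/2" 1 1 "\<lambda>s. \<bar>dirichlet N s\<bar>"] by simp
  moreover have "integral {0..1/2} (\<lambda>s. \<bar>dirichlet N s\<bar>) + integral {1/2..1} (\<lambda>s. \<bar>dirichlet N s\<bar>)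
      = integral {0..1} (\<lambda>s. \<bar>dirichlet N s\<bar>)"
    by (intro Henstock_Kurzweil_Integration.integral_combine integrable_continuous_real continuous_intros) auto
  moreover have "integral {-1/2..0} (\<lambda>s. \<bar>dirichlet N s\<bar>) + integral {0..1/2} (\<lambda>s. \<bar>dirichlet N s\<bar>)
      = integral {-1/2..1/2} (\<lambda>s. \<bar>dirichlet N s\<bar>)"
    by (intro Henstock_Kurzweil_Integration.integral_combine integrable_continuous_real continuous_intros) auto
  ultimately show ?thesis using integral_abs_dirichlet_symmetric[of N] by simp
qed

section \<open>The L^2 and L^1 norms of the primitive\<close>

lemma has_integral_cos_unit:
  assumes "r \<in> \<int>" "r \<noteq> 0"
  shows "((\<lambda>s. cos (2 * pi * r * s)) has_integral 0) {0..1}"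
proof -
  have "((\<lambda>s. cos (2 * pi * r * s)) has_integral
      sin (2 * pi * r * 1) / (2 * pi * r) - sin (2 * pi * r * 0) / (2 * pi * r)) {0..1}"
    using assms
    by (intro fundamental_theorem_of_calculus)
      (auto simp: has_real_derivative_iff_has_vector_derivative[symmetric] intro!: derivative_eq_intros)
  moreover have "sin (2 * pi * r) = 0"
    using assms by (metis mult.assoc mult.commute sin_integer_2pi)
  ultimately show ?thesis by simp
qed

lemma has_integral_sin_mult_sin:
  fixes k m :: nat
  assumes "0 < k" "0 < m"
  shows "((\<lambda>s. sin (2 * pi * real k * s) * sin (2 * pi * real m * s)) has_integral
    (if k = m then 1/2 else 0)) {0..1}"
proof -
  have eq: "sin (2 * pi * real k * s) * sin (2 * pi * real m * s) =
      (1/2) * cos (2 * pi * (real k - real m) * s) - (1/2) * cos (2 * pi * (real k + real m) * s)" for s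
    by (simp add: left_diff_distrib right_diff_distrib distrib_left distrib_right cos_add cos_diff)
  have 1: "((\<lambda>s. cos (2 * pi * (real k - real m) * s)) has_integral (if k = m then 1 else 0)) {0..1}"
    using has_integral_cos_unit[of "real k - real m"] has_integral_const_real[of "1::real" 0 1] by auto
  have 2: "((\<lambda>s. cos (2 * pi * (real k + real m) * s)) has_integral 0) {0..1}"
    using assms by (intro has_integral_cos_unit) auto
  show ?thesis unfolding eq
    using has_integral_diff[OF has_integral_mult_right[OF 1, of "1/2"] has_integral_mult_right[OF 2, of "1/2"]]
    by (auto split: if_splits)
qed

lemma has_integral_linear_mult_sin:
  fixes m :: nat
  assumes "0 < m"
  shows "((\<lambda>s. (1/2 - s) * sin (2 * pi * real m * s)) has_integral 1 / (2 * pi * real m)) {0..1}"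
proof -
  define F where "F s = - (1/2 - s) * cos (2 * pi * real m * s) / (2 * pi * real m)
      - sin (2 * pi * real m * s) / (2 * pi * real m)^2" for s
  have "((\<lambda>s. (1/2 - s) * sin (2 * pi * real m * s)) has_integral F 1 - F 0) {0..1}"
  proof (rule fundamental_theorem_of_calculus)
    fix s :: real assume "s \<in> {0..1}"
    show "(F has_vector_derivative (1/2 - s) * sin (2 * pi * real m * s)) (at s within {0..1})"
      unfolding F_def has_real_derivative_iff_has_vector_derivative[symmetric] using assms
      by (auto intro!: derivative_eq_intros simp: field_simps power2_eq_square)
  qed simp
  moreover have "F 1 - F 0 = 1 / (2 * pi * real m)"
    using cos_period_int[of m 0] sin_period_int[of m 0] assms
    by (simp add: F_def field_simps)
  ultimately show ?thesis by simp
qed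

text \<open>The subtracted sines have frequencies at most \<open>N\<close> and are orthogonal to the
  one of frequency \<open>m\<close>, so only the sawtooth contributes.\<close>

lemma has_integral_dirichlet_primitive_mult_sin:
  assumes "N < m"
  shows "((\<lambda>s. dirichlet_primitive N s * sin (2 * pi * real m * s)) has_integral 1 / (2 * pi * real m)) {0..1}"
proof -
  have "((\<lambda>s. \<Sum>k=1..N. (1 / (pi * real k)) * (sin (2 * pi * real k * s) * sin (2 * pi * real m * s)))
      has_integral (\<Sum>k=1..N. (1 / (pi * real k)) * 0)) {0..1}"
  proof (intro has_integral_sum has_integral_mult_right)
    fix k assume "k \<in> {1..N}"
    then show "((\<lambda>s. sin (2 * pi * real k * s) * sin (2 * pi * real m * s)) has_integral 0) {0..1}"
      using has_integral_sin_mult_sin[of k m] assms by simp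
  qed simp
  from has_integral_diff[OF has_integral_linear_mult_sin[of m] this] assms show ?thesis
    by (simp add: dirichlet_primitive_def left_diff_distrib sum_distrib_right)
qed

text \<open>Bessel's identity for the sawtooth, whose squared norm is \<open>1/12\<close>. Removing
  the term of frequency \<open>m\<close> changes the integral by -1/(pi m)^2 from the cross term and
  by half of 1/(pi m)^2 from the square.\<close>

lemma has_integral_dirichlet_primitive_square:
  "((\<lambda>s. (dirichlet_primitive N s)^2) has_integral (1/12 - (\<Sum>k=1..N. 1 / (2 * pi^2 * real k^2)))) {0..1}"
proof (induction N)
  case 0
  have "((\<lambda>s. (1/2 - s)^2) has_integral (- ((1/2 - 1)^3/3)) - (- ((1/2 - 0)^3/3))) {0..1::real}"
    by (rule fundamental_theorem_of_calculus)
      (auto simp: has_real_derivative_iff_has_vector_derivative[symmetric] power2_eq_square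
        intro!: derivative_eq_intros)
  then show ?case by (simp add: dirichlet_primitive_def power3_eq_cube)
next
  case (Suc N)
  define m where "m = Suc N"
  have m: "0 < m" "N < m" by (auto simp: m_def)
  have eq: "(dirichlet_primitive m s)^2 = (dirichlet_primitive N s)^2
      - (2 / (pi * real m)) * (dirichlet_primitive N s * sin (2 * pi * real m * s))
      + (1 / (pi * real m)^2) * (sin (2 * pi * real m * s) * sin (2 * pi * real m * s))" for s
  proof -
    define b where "b = sin (2 * pi * real m * s) / (pi * real m)"
    have "dirichlet_primitive m s = dirichlet_primitive N s - b"
      by (simp add: dirichlet_primitive_def m_def b_def)
    then have "(dirichlet_primitive m s)^2
        = (dirichlet_primitive N s)^2 - 2 * dirichlet_primitive N s * b + b * b"
      by (simp only: power2_diff) (simp add: power2_eq_square)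
    then show ?thesis by (simp add: b_def power2_eq_square)
  qed
  have sin: "((\<lambda>s. sin (2 * pi * real m * s) * sin (2 * pi * real m * s)) has_integral 1/2) {0..1}"
    using has_integral_sin_mult_sin[of m m] m by simp
  have *: "((\<lambda>s. (dirichlet_primitive m s)^2) has_integral
      (1/12 - (\<Sum>k=1..N. 1 / (2 * pi^2 * real k^2))) - (2 / (pi * real m)) * (1 / (2 * pi * real m))
      + (1 / (pi * real m)^2) * (1/2)) {0..1}"
    unfolding eq
    by (intro has_integral_add has_integral_diff has_integral_mult_right Suc.IH
        has_integral_dirichlet_primitive_mult_sin sin m)
  have "(2 / (pi * real m)) * (1 / (2 * pi * real m)) - (1 / (pi * real m)^2) * (1/2)
     = 1 / (2 * pi^2 * real m ^2)"
    using m by (simp add: field_simps power2_eq_square)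
  moreover have "(\<Sum>k=1..m. 1 / (2 * pi^2 * real k^2))
      = (\<Sum>k=1..N. 1 / (2 * pi^2 * real k^2)) + 1 / (2 * pi^2 * real m ^2)"
    by (simp add: m_def)
  ultimately show ?case
    unfolding m_def[symmetric] by (intro has_integral_eq_rhs[OF *]) linarith
qed

text \<open>The quantity \<open>(\<Sum>k=1..M. 1 / real k^2) + 1 / real M\<close> decreases in
  \<open>M\<close>, because 1/(M+1)^2 \<le> 1/M - 1/(M+1). The Basel limit is therefore at most its
  value at \<open>N\<close>.\<close>

lemma inverse_squares_tail_le:
  assumes "0 < N"
  shows "pi^2/6 - (\<Sum>k=1..N. 1 / real k^2) \<le> 1 / real N"
proof -
  have le: "(\<Sum>k=1..M. 1 / real k^2) + 1 / real M \<le> (\<Sum>k=1..N. 1 / real k^2) + 1 / real N"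
    if "N \<le> M" for M using that
  proof (induction M rule: dec_induct)
    case (step M)
    have "1 / real (Suc M)^2 + 1 / real (Suc M) \<le> 1 / real M"
      using step assms by (simp add: divide_simps power2_eq_square) (simp add: algebra_simps)
    with step.IH show ?case by simp
  qed simp
  have "(\<lambda>M. \<Sum>k<M. 1 / (real k + 1)^2) \<longlonglongrightarrow> pi^2/6"
    using inverse_squares_sums by (simp add: sums_def add.commute)
  moreover have "(\<Sum>k<M. 1 / (real k + 1)^2) = (\<Sum>k=1..M. 1 / real k^2)" for M
    by (induction M) (auto simp: add.commute)
  ultimately have "(\<lambda>M. \<Sum>k=1..M. 1 / real k^2) \<longlonglongrightarrow> pi^2/6" by simp
  then have "pi^2/6 \<le> (\<Sum>k=1..N. 1 / real k^2) + 1 / real N"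
  proof (rule LIMSEQ_le_const2)
    show "\<exists>M0. \<forall>M\<ge>M0. (\<Sum>k=1..M. 1 / real k^2) \<le> (\<Sum>k=1..N. 1 / real k^2) + 1 / real N"
      by (intro exI[of _ N] allI impI) (use le in \<open>smt (verit) divide_nonneg_nonneg of_nat_0_le_iff\<close>)
  qed
  then show ?thesis by simp
qed

text \<open>Cauchy-Schwarz in its pointwise form: \<open>0 \<le> (1 - q * d)^2\<close> gives d \<le>
  1/(2q) + (q/2) d^2. The choice \<open>q = sqrt (real N)\<close> balances both terms, as the
  integral of the square is at most 1/q^2.\<close>

lemma integral_abs_dirichlet_primitive:
  assumes "0 < N"
  shows "integral {0..1} (\<lambda>s. \<bar>dirichlet_primitive N s\<bar>) \<le> 1 / sqrt (real N)"
proof -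
  define q where "q = sqrt (real N)"
  have q: "q > 0" "real N = q * q" using assms by (auto simp: q_def)
  let ?I = "1/12 - (\<Sum>k=1..N. 1 / (2 * pi^2 * real k^2))"
  have "?I = (pi^2/6 - (\<Sum>k=1..N. 1 / real k^2)) / (2 * pi^2)"
    by (simp add: diff_divide_distrib sum_divide_distrib mult_ac)
  also have "\<dots> \<le> (1 / real N) / (2 * pi^2)"
    using inverse_squares_tail_le[OF assms] by (intro divide_right_mono) auto
  \<comment> \<open>Only the order in \<open>N\<close> matters later, so the favourable factor
    \<open>2 * pi^2\<close> is given away.\<close>
  also have "\<dots> \<le> (1 / real N) / 1"
  proof -
    have "2 * pi^2 \<ge> 2 * 1^2" using pi_ge_two by (intro mult_left_mono power_mono) auto
    then show ?thesis by (intro divide_left_mono) auto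
  qed
  finally have I: "?I \<le> 1 / (q * q)" by (simp add: q)
  have *: "((\<lambda>s. (1/q) / 2 + (q / 2) * (dirichlet_primitive N s)^2) has_integral
      (1/q) / 2 + (q / 2) * ?I) {0..1}"
    using has_integral_const_real[of "(1/q) / 2" 0 1]
    by (intro has_integral_add has_integral_mult_right has_integral_dirichlet_primitive_square) simp
  have "integral {0..1} (\<lambda>s. \<bar>dirichlet_primitive N s\<bar>)
      \<le> integral {0..1} (\<lambda>s. (1/q) / 2 + (q / 2) * (dirichlet_primitive N s)^2)"
  proof (rule integral_le)
    show "(\<lambda>s. \<bar>dirichlet_primitive N s\<bar>) integrable_on {0..1}"
      by (intro integrable_continuous_real continuous_intros)
    show "(\<lambda>s. (1/q) / 2 + (q / 2) * (dirichlet_primitive N s)^2) integrable_on {0..1}"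
      using * by blast
    fix s
    define d where "d = \<bar>dirichlet_primitive N s\<bar>"
    have "0 \<le> (1 - q * d)^2 / (2 * q)" using q by simp
    also have "\<dots> = (1/q) / 2 + (q / 2) * d^2 - d"
      using q by (simp add: divide_simps) (simp add: power2_eq_square algebra_simps)
    finally show "\<bar>dirichlet_primitive N s\<bar> \<le> (1/q) / 2 + (q / 2) * (dirichlet_primitive N s)^2"
      by (simp add: d_def)
  qed
  also have "\<dots> = (1/q) / 2 + (q / 2) * ?I"
    using integral_unique[OF *] by simp
  also have "\<dots> \<le> (1/q) / 2 + (q / 2) * (1 / (q * q))"
    using I q by (intro add_left_mono mult_left_mono) auto
  also have "\<dots> = 1 / q"
    using q by simp
  finally show ?thesis by (simp add: q_def)
qed

section \<open>One-dimensional cosine sums\<close>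

text \<open>The cutoff to [0,1/2] is part of the kernel, so that it can be integrated over all of
  \<open>lborel\<close> and multiplied over coordinates in a product measure.\<close>

definition cos_kernel :: "nat \<Rightarrow> real \<Rightarrow> real \<Rightarrow> real" where
  "cos_kernel N x t = (if t \<in> {0..1/2} then dirichlet N (x - t) + dirichlet N (x + t) else 0)"

lemma cos_kernel_eq_indicator:
  "cos_kernel N x t = indicator {0..1/2} t *\<^sub>R (dirichlet N (x - t) + dirichlet N (x + t))"
  by (simp add: cos_kernel_def indicator_def)

lemma integrable_indicator_mult_continuous:
  fixes g :: "real \<Rightarrow> real"
  assumes "continuous_on {a..b} g"
  shows "integrable lborel (\<lambda>t. indicator {a..b} t * g t)"
    and "(LINT t|lborel. indicator {a..b} t * g t) = integral {a..b} g"
  using borel_integrable_atLeastAtMost'[OF assms] set_borel_integral_eq_integral(2)[of "{a..b}" g]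
  by (auto simp: set_integrable_def set_lebesgue_integral_def)

lemma integrable_cos_kernel: "integrable lborel (cos_kernel N x)"
  unfolding cos_kernel_eq_indicator real_scaleR_def
  by (intro integrable_indicator_mult_continuous continuous_intros)

lemma borel_measurable_dirichlet [measurable]: "dirichlet N \<in> borel_measurable borel"
  by (intro borel_measurable_continuous_onI continuous_intros)

lemma borel_measurable_cos_kernel [measurable]: "cos_kernel N x \<in> borel_measurable borel"
  unfolding cos_kernel_def by measurable

lemma integral_abs_cos_kernel:
  assumes "0 \<le> x" "x \<le> 1/2"
  shows "(LINT t|lborel. \<bar>cos_kernel N x t\<bar>) \<le> 4 * ln (2 * real N + 2)"
proof -
  let ?D = "\<lambda>s. \<bar>dirichlet N s\<bar>"
  have cont: "continuous_on S ?D" for S by (intro continuous_intros)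
  have 1: "integral {0..1/2} (\<lambda>t. ?D (x + t)) \<le> 2 * ln (2 * real N + 2)"
  proof -
    have "integral {0..1/2} (\<lambda>t. ?D (x + t)) = integral {x..x+1/2} ?D"
      using integral_shift_real_ivl[of x x "x+1/2" ?D] by (simp add: add.commute)
    also have "\<dots> \<le> integral {0..1} ?D"
      using assms by (intro integral_subset_le integrable_continuous_real cont) auto
    finally show ?thesis using integral_abs_dirichlet_unit[of N] by simp
  qed
  have 2: "integral {0..1/2} (\<lambda>t. ?D (x - t)) \<le> 2 * ln (2 * real N + 2)"
  proof -
    have "integral {0..1/2} (\<lambda>t. ?D (x - t)) = integral {0..1/2} (\<lambda>t. ?D (t + (- x)))"
      using dirichlet_minus[of N "x - t" for t] by (intro integral_cong) (simp del: dirichlet_minus)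
    also have "\<dots> = integral {-x..1/2-x} ?D"
      using integral_shift_real_ivl[of "-x" "-x" "1/2-x" ?D] by simp
    also have "\<dots> \<le> integral {-1/2..1/2} ?D"
      using assms by (intro integral_subset_le integrable_continuous_real cont) auto
    finally show ?thesis using integral_abs_dirichlet_symmetric[of N] by simp
  qed
  have "(LINT t|lborel. \<bar>cos_kernel N x t\<bar>)
      = (LINT t|lborel. indicator {0..1/2} t * \<bar>dirichlet N (x - t) + dirichlet N (x + t)\<bar>)"
    by (simp add: cos_kernel_eq_indicator abs_mult)
  also have "\<dots> = integral {0..1/2} (\<lambda>t. \<bar>dirichlet N (x - t) + dirichlet N (x + t)\<bar>)"
    by (intro integrable_indicator_mult_continuous continuous_intros)
  also have "\<dots> \<le> integral {0..1/2} (\<lambda>t. ?D (x - t) + ?D (x + t))"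
    by (intro integral_le integrable_continuous_real continuous_intros abs_triangle_ineq)
  also have "\<dots> = integral {0..1/2} (\<lambda>t. ?D (x - t)) + integral {0..1/2} (\<lambda>t. ?D (x + t))"
    by (intro Henstock_Kurzweil_Integration.integral_add integrable_continuous_real continuous_intros)
  finally show ?thesis using 1 2 by simp
qed

lemma abs_integral_mult_le:
  fixes g h :: "real \<Rightarrow> real"
  assumes "continuous_on {a..b} g" "continuous_on {a..b} h" "\<And>t. \<bar>g t\<bar> \<le> B"
  shows "\<bar>integral {a..b} (\<lambda>t. g t * h t)\<bar> \<le> B * integral {a..b} (\<lambda>t. \<bar>h t\<bar>)"
proof -
  have "\<bar>integral {a..b} (\<lambda>t. g t * h t)\<bar> \<le> integral {a..b} (\<lambda>t. B * \<bar>h t\<bar>)"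
  unfolding real_norm_def[symmetric]
  proof (rule integral_norm_bound_integral)
    show "(\<lambda>t. g t * h t) integrable_on {a..b}" "(\<lambda>t. B * norm (h t)) integrable_on {a..b}"
      using assms(1,2) by (auto intro!: integrable_continuous_real continuous_intros)
    show "norm (g t * h t) \<le> B * norm (h t)" for t
      using assms(3)[of t] by (simp add: abs_mult mult_right_mono)
  qed
  then show ?thesis by simp
qed

text \<open>As a function of \<open>t\<close>, the kernel is the derivative of K(x-t) - K(x+t) for t
  < x and of -K(t-x) - K(x+t) for t > x. These primitives vanish at 0 and at 1/2 respectively, and
  across \<open>t = x\<close> they drop by 2 K(0) = 1, which yields \<open>g x\<close>. What remains
  is \<open>g'\<close> against three integrals of |K|, hence the constant 3.\<close>

lemma cos_kernel_approximates:
  fixes g g' :: "real \<Rightarrow> real"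
  assumes deriv: "\<And>t. (g has_real_derivative g' t) (at t)"
    and cont: "continuous_on UNIV g'"
    and bound: "\<And>t. \<bar>g' t\<bar> \<le> B"
    and x: "0 \<le> x" "x \<le> 1/2" and N: "0 < N"
  shows "\<bar>g x - (LINT t|lborel. g t * cos_kernel N x t)\<bar> \<le> 3 * B / sqrt (real N)"
proof -
  let ?D = "dirichlet N" and ?K = "dirichlet_primitive N"
  have B: "B \<ge> 0" using bound[of 0] by simp
  have contg: "continuous_on S g" for S
    using deriv by (meson DERIV_continuous_on has_field_derivative_at_within)
  have contg': "continuous_on S g'" for S using cont continuous_on_subset by blast
  note dK = DERIV_chain2[OF has_derivative_dirichlet_primitive]
  have 1: "((\<lambda>t. g' t * (?K (x - t) - ?K (x + t)) + g t * (?D (x - t) + ?D (x + t)))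
      has_integral g x * (1/2 - ?K (2 * x))) {0..x}"
  proof -
    have "((\<lambda>t. g t * (?K (x - t) - ?K (x + t))) has_real_derivative
        g' t * (?K (x - t) - ?K (x + t)) + g t * (?D (x - t) + ?D (x + t))) (at t)" for t
    proof -
      have "((\<lambda>t. g t * (?K (x - t) - ?K (x + t))) has_real_derivative
        g' t * (?K (x - t) - ?K (x + t)) + (- ?D (x - t) * (0 - 1) - (- ?D (x + t)) * (0 + 1)) * g t) (at t)"
        by (intro DERIV_mult deriv DERIV_diff dK DERIV_add DERIV_const DERIV_ident)
      then show ?thesis by (simp add: algebra_simps)
    qed
    then have "((\<lambda>t. g' t * (?K (x - t) - ?K (x + t)) + g t * (?D (x - t) + ?D (x + t)))
      has_integral g x * (?K (x - x) - ?K (x + x)) - g 0 * (?K (x - 0) - ?K (x + 0))) {0..x}"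
      using x by (intro fundamental_theorem_of_calculus)
        (auto simp: has_real_derivative_iff_has_vector_derivative[symmetric]
          intro: has_field_derivative_at_within)
    then show ?thesis by (simp add: dirichlet_primitive_0)
  qed
  \<comment> \<open>For t > x the argument x - t is negative. The branch -K(t-x) equals K(x-t) - 1,
    so it has the same derivative, but its argument is back in [0,1].\<close>
  have 2: "((\<lambda>t. g' t * (- ?K (t - x) - ?K (x + t)) + g t * (?D (x - t) + ?D (x + t)))
      has_integral - g x * (- 1/2 - ?K (2 * x))) {x..1/2}"
  proof -
    have "((\<lambda>t. g t * (- ?K (t - x) - ?K (x + t))) has_real_derivative
        g' t * (- ?K (t - x) - ?K (x + t)) + g t * (?D (x - t) + ?D (x + t))) (at t)" for t
    proof -
      have "((\<lambda>t. g t * (- ?K (t - x) - ?K (x + t))) has_real_derivative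
        g' t * (- ?K (t - x) - ?K (x + t))
          + (- (- ?D (t - x) * (1 - 0)) - (- ?D (x + t)) * (0 + 1)) * g t) (at t)"
        by (intro DERIV_mult deriv DERIV_diff DERIV_minus dK DERIV_add DERIV_const DERIV_ident)
      moreover have "?D (t - x) = ?D (x - t)"
        using dirichlet_minus[of N "x - t"] by simp
      ultimately show ?thesis by (simp add: algebra_simps)
    qed
    then have "((\<lambda>t. g' t * (- ?K (t - x) - ?K (x + t)) + g t * (?D (x - t) + ?D (x + t)))
      has_integral g (1/2) * (- ?K (1/2 - x) - ?K (x + 1/2)) - g x * (- ?K (x - x) - ?K (x + x))) {x..1/2}"
      using x by (intro fundamental_theorem_of_calculus)
        (auto simp: has_real_derivative_iff_has_vector_derivative[symmetric]
          intro: has_field_derivative_at_within)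
    moreover have "?K (1/2 - x) = - ?K (x + 1/2)"
      using dirichlet_primitive_reflect[of N "x + 1/2"] by simp
    ultimately show ?thesis by (simp add: dirichlet_primitive_0)
  qed
  let ?h = "\<lambda>t. g t * (?D (x - t) + ?D (x + t))"
  have "(LINT t|lborel. g t * cos_kernel N x t) = (LINT t|lborel. indicator {0..1/2} t * ?h t)"
    by (simp add: cos_kernel_eq_indicator mult_ac)
  also have "\<dots> = integral {0..1/2} ?h"
    by (intro integrable_indicator_mult_continuous continuous_intros contg)
  also have "\<dots> = integral {0..x} ?h + integral {x..1/2} ?h"
    using x by (intro Henstock_Kurzweil_Integration.integral_combine[symmetric]
        integrable_continuous_real continuous_intros contg)
  also have "integral {0..x} ?h = g x * (1/2 - ?K (2 * x)) - integral {0..x} (\<lambda>t. g' t * (?K (x - t) - ?K (x + t)))"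
  proof -
    have "(\<lambda>t. g' t * (?K (x - t) - ?K (x + t))) integrable_on {0..x}"
      by (intro integrable_continuous_real continuous_intros contg')
    from has_integral_diff[OF 1 integrable_integral[OF this]] show ?thesis
      by (simp add: integral_unique)
  qed
  also have "integral {x..1/2} ?h = - g x * (- 1/2 - ?K (2 * x)) - integral {x..1/2} (\<lambda>t. g' t * (- ?K (t - x) - ?K (x + t)))"
  proof -
    have "(\<lambda>t. g' t * (- ?K (t - x) - ?K (x + t))) integrable_on {x..1/2}"
      by (intro integrable_continuous_real continuous_intros contg')
    from has_integral_diff[OF 2 integrable_integral[OF this]] show ?thesis
      by (simp add: integral_unique)
  qed
  finally have "g x - (LINT t|lborel. g t * cos_kernel N x t)
      = integral {0..x} (\<lambda>t. g' t * (?K (x - t) - ?K (x + t)))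
        + integral {x..1/2} (\<lambda>t. g' t * (- ?K (t - x) - ?K (x + t)))"
    by (simp add: algebra_simps)
  then have "\<bar>g x - (LINT t|lborel. g t * cos_kernel N x t)\<bar>
      \<le> \<bar>integral {0..x} (\<lambda>t. g' t * (?K (x - t) - ?K (x + t)))\<bar>
        + \<bar>integral {x..1/2} (\<lambda>t. g' t * (- ?K (t - x) - ?K (x + t)))\<bar>"
    by simp
  also have "\<dots> \<le> B * integral {0..x} (\<lambda>t. \<bar>?K (x - t) - ?K (x + t)\<bar>)
        + B * integral {x..1/2} (\<lambda>t. \<bar>- ?K (t - x) - ?K (x + t)\<bar>)"
    by (intro add_mono abs_integral_mult_le continuous_intros contg' bound)
  also have "\<dots> \<le> B * (integral {0..x} (\<lambda>t. \<bar>?K (x - t)\<bar>) + integral {0..x} (\<lambda>t. \<bar>?K (x + t)\<bar>))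
        + B * (integral {x..1/2} (\<lambda>t. \<bar>?K (t - x)\<bar>) + integral {x..1/2} (\<lambda>t. \<bar>?K (x + t)\<bar>))"
  proof -
    have "integral {0..x} (\<lambda>t. \<bar>?K (x - t) - ?K (x + t)\<bar>) \<le> integral {0..x} (\<lambda>t. \<bar>?K (x - t)\<bar> + \<bar>?K (x + t)\<bar>)"
      by (intro integral_le integrable_continuous_real continuous_intros abs_triangle_ineq4)
    also have "\<dots> = integral {0..x} (\<lambda>t. \<bar>?K (x - t)\<bar>) + integral {0..x} (\<lambda>t. \<bar>?K (x + t)\<bar>)"
      by (intro Henstock_Kurzweil_Integration.integral_add integrable_continuous_real continuous_intros)
    finally have a: "integral {0..x} (\<lambda>t. \<bar>?K (x - t) - ?K (x + t)\<bar>) \<le> \<dots>" .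
    have "integral {x..1/2} (\<lambda>t. \<bar>- ?K (t - x) - ?K (x + t)\<bar>) \<le> integral {x..1/2} (\<lambda>t. \<bar>?K (t - x)\<bar> + \<bar>?K (x + t)\<bar>)"
      by (intro integral_le integrable_continuous_real continuous_intros) auto
    also have "\<dots> = integral {x..1/2} (\<lambda>t. \<bar>?K (t - x)\<bar>) + integral {x..1/2} (\<lambda>t. \<bar>?K (x + t)\<bar>)"
      by (intro Henstock_Kurzweil_Integration.integral_add integrable_continuous_real continuous_intros)
    finally have b: "integral {x..1/2} (\<lambda>t. \<bar>- ?K (t - x) - ?K (x + t)\<bar>) \<le> \<dots>" .
    show ?thesis by (intro add_mono mult_left_mono a b B)
  qed
  also have "\<dots> = B * (integral {0..x} (\<lambda>t. \<bar>?K (x - t)\<bar>) + integral {x..1/2} (\<lambda>t. \<bar>?K (t - x)\<bar>)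
      + (integral {0..x} (\<lambda>t. \<bar>?K (x + t)\<bar>) + integral {x..1/2} (\<lambda>t. \<bar>?K (x + t)\<bar>)))"
    by (simp add: algebra_simps)
  also have "integral {0..x} (\<lambda>t. \<bar>?K (x + t)\<bar>) + integral {x..1/2} (\<lambda>t. \<bar>?K (x + t)\<bar>)
      = integral {0..1/2} (\<lambda>t. \<bar>?K (x + t)\<bar>)"
    using x by (intro Henstock_Kurzweil_Integration.integral_combine
        integrable_continuous_real continuous_intros)
  also have "B * (integral {0..x} (\<lambda>t. \<bar>?K (x - t)\<bar>) + integral {x..1/2} (\<lambda>t. \<bar>?K (t - x)\<bar>)
      + integral {0..1/2} (\<lambda>t. \<bar>?K (x + t)\<bar>))
    \<le> B * (1 / sqrt (real N) + 1 / sqrt (real N) + 1 / sqrt (real N))"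
  proof (intro mult_left_mono add_mono B)
    let ?A = "\<lambda>t. \<bar>?K t\<bar>"
    \<comment> \<open>After substitution, each of the three arguments sweeps an interval inside
      [0,1], where the L^1 bound on the primitive applies.\<close>
    have sub: "integral {a..b} ?A \<le> 1 / sqrt (real N)" if "0 \<le> a" "b \<le> 1" for a b
    proof -
      have "integral {a..b} ?A \<le> integral {0..1} ?A"
        using that by (intro integral_subset_le integrable_continuous_real continuous_intros) auto
      then show ?thesis using integral_abs_dirichlet_primitive[OF N] by simp
    qed
    have "integral {0..x} (\<lambda>t. ?A (x - t)) = integral {-x..0} (\<lambda>t. ?A (- t))"
      using integral_shift_real_ivl[of "-x" "-x" 0 "\<lambda>t. ?A (- t)"] by simp
    also have "\<dots> = integral {0..x} ?A"
      using Henstock_Kurzweil_Integration.integral_reflect_real[of x 0 ?A] by simp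
    also note sub
    finally show "integral {0..x} (\<lambda>t. ?A (x - t)) \<le> 1 / sqrt (real N)" using x by simp
    have "integral {x..1/2} (\<lambda>t. ?A (t - x)) = integral {0..1/2-x} ?A"
      using integral_shift_real_ivl[of 0 "-x" "1/2-x" ?A] by simp
    also note sub
    finally show "integral {x..1/2} (\<lambda>t. ?A (t - x)) \<le> 1 / sqrt (real N)" using x by simp
    have "integral {0..1/2} (\<lambda>t. ?A (x + t)) = integral {x..x+1/2} ?A"
      using integral_shift_real_ivl[of x x "x+1/2" ?A] by (simp add: add.commute)
    also note sub
    finally show "integral {0..1/2} (\<lambda>t. ?A (x + t)) \<le> 1 / sqrt (real N)" using x by simp
  qed
  finally show ?thesis by (simp add: mult.commute)
qed

section \<open>Tensor products of kernels\<close>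

text \<open>Replacing the coordinates one at a time costs the one-dimensional error \<open>E\<close>, amplified by
  the \<open>L\<^sup>1\<close> norms of the kernels already applied.\<close>

lemma tensor_kernel_approximates:
  fixes F :: "('i \<Rightarrow> real) \<Rightarrow> real" and h :: "'i \<Rightarrow> real \<Rightarrow> real"
  assumes A: "finite A"
    and F [measurable]: "F \<in> borel_measurable (Pi\<^sub>M UNIV (\<lambda>_. borel))"
    and F_bound: "\<And>y. \<bar>F y\<bar> \<le> b"
    and h: "\<And>i. integrable lborel (h i)" and h_le: "\<And>i. (LINT t|lborel. \<bar>h i t\<bar>) \<le> L"
    and approx: "\<And>i z. z i = x i \<Longrightarrow> \<bar>F z - (LINT t|lborel. F (z(i := t)) * h i t)\<bar> \<le> E"
  shows "\<bar>F x - (LINT y|Pi\<^sub>M A (\<lambda>_. lborel). F (override_on x y A) * (\<Prod>i\<in>A. h i (y i)))\<bar>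
    \<le> E * (\<Sum>k<card A. L ^ k)"
  using A
proof (induction A rule: finite_induct)
  case empty
  then show ?case by (simp add: PiM_empty lebesgue_integral_count_space_finite)
next
  case (insert a A)
  interpret product_sigma_finite "\<lambda>_::'i. lborel :: real measure" by standard
  let ?P = "\<lambda>B y. \<Prod>i\<in>B. h i (y i)" and ?M = "\<lambda>B. Pi\<^sub>M B (\<lambda>_::'i. lborel :: real measure)"
  have [measurable]: "h i \<in> borel_measurable borel" for i
    using borel_measurable_integrable[OF h[of i]] by simp
  have b: "b \<ge> 0" using F_bound[of x] by linarith
  have E: "E \<ge> 0" using approx[of x a] by linarith
  have [measurable]: "(\<lambda>y. override_on x y B) \<in> measurable (?M B) (Pi\<^sub>M UNIV (\<lambda>_. borel))" for B
  proof -
    have "(\<lambda>y i. if i \<in> B then y i else x i) \<in> measurable (?M B) (Pi\<^sub>M UNIV (\<lambda>_. borel))"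
    proof (rule measurable_PiM_single')
      show "(\<lambda>y. if i \<in> B then y i else x i) \<in> borel_measurable (?M B)" for i
        by (cases "i \<in> B") auto
    qed auto
    then show ?thesis by (simp add: override_on_def[abs_def])
  qed
  have intP: "integrable (?M B) (?P B)" if "finite B" for B
    using that h by (intro product_integrable_prod)
  have int: "integrable (?M B) (\<lambda>y. F (override_on x y B) * ?P B y)" if "finite B" for B
  proof (rule Bochner_Integration.integrable_bound)
    show "integrable (?M B) (\<lambda>y. b * ?P B y)" using intP[OF that] by simp
    show "(\<lambda>y. F (override_on x y B) * ?P B y) \<in> borel_measurable (?M B)"
      using borel_measurable_integrable[OF intP[OF that]] by measurable
    show "AE y in ?M B. norm (F (override_on x y B) * ?P B y) \<le> norm (b * ?P B y)"
      using F_bound b by (intro AE_I2) (simp add: abs_mult mult_right_mono)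
  qed
  \<comment> \<open>\<open>G\<close> integrates out the new coordinate alone, and Fubini turns the
    integral over \<open>insert a A\<close> into one of \<open>G\<close> over \<open>A\<close>.
    Since \<open>a\<close> is not in \<open>A\<close>, the point \<open>override_on x y A\<close>
    still has the entry \<open>x a\<close> there, as \<open>approx\<close> demands.\<close>
  define G where "G y = (LINT t|lborel. F ((override_on x y A)(a := t)) * h a t)" for y
  have ov: "override_on x (y(a := t)) (insert a A) = (override_on x y A)(a := t)" for y t
    by (auto simp: override_on_def)
  have G_approx: "\<bar>F (override_on x y A) - G y\<bar> \<le> E" for y
    unfolding G_def using insert.hyps by (intro approx) (simp add: override_on_def)
  have [measurable]: "G \<in> borel_measurable (?M A)"
  proof -
    have [measurable]: "(\<lambda>p. (override_on x (fst p) A)(a := snd p)) \<in>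
        measurable (?M A \<Otimes>\<^sub>M lborel) (Pi\<^sub>M UNIV (\<lambda>_. borel))"
    proof -
      have "(\<lambda>p i. if i = a then snd p else if i \<in> A then fst p i else x i)
          \<in> measurable (?M A \<Otimes>\<^sub>M lborel) (Pi\<^sub>M UNIV (\<lambda>_. borel))"
      proof (rule measurable_PiM_single')
        show "(\<lambda>p. if i = a then snd p else if i \<in> A then fst p i else x i)
            \<in> borel_measurable (?M A \<Otimes>\<^sub>M lborel)" for i
          by (cases "i = a"; cases "i \<in> A") auto
      qed auto
      then show ?thesis by (simp add: override_on_def[abs_def] fun_upd_def)
    qed
    show ?thesis unfolding G_def
      by (intro sigma_finite_measure.borel_measurable_lebesgue_integral[OF sigma_finite_lborel])
        (simp add: case_prod_beta')
  qed
  have intG: "integrable (?M A) (\<lambda>y. G y * ?P A y)"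
  proof (rule Bochner_Integration.integrable_bound)
    show "integrable (?M A) (\<lambda>y. (b + E) * ?P A y)" using intP insert.hyps by simp
    show "(\<lambda>y. G y * ?P A y) \<in> borel_measurable (?M A)"
      using borel_measurable_integrable[OF intP] insert.hyps by measurable
    have "\<bar>G y\<bar> \<le> b + E" for y
      using G_approx[of y] F_bound[of "override_on x y A"] by linarith
    then show "AE y in ?M A. norm (G y * ?P A y) \<le> norm ((b + E) * ?P A y)"
      using b E by (intro AE_I2) (simp add: abs_mult mult_right_mono)
  qed
  have step: "(LINT y|?M (insert a A). F (override_on x y (insert a A)) * ?P (insert a A) y)
      = (LINT y|?M A. G y * ?P A y)"
  proof -
    have P: "?P (insert a A) (y(a := t)) = ?P A y * h a t" for y t
    proof -
      have "?P A (y(a := t)) = ?P A y"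
        using insert.hyps by (intro prod.cong) auto
      then show ?thesis using insert.hyps by (simp add: mult.commute)
    qed
    have "(LINT y|?M (insert a A). F (override_on x y (insert a A)) * ?P (insert a A) y)
      = (LINT y|?M A. (LINT t|lborel. F (override_on x (y(a := t)) (insert a A)) * ?P (insert a A) (y(a := t))))"
      using insert.hyps by (intro product_integral_insert int) auto
    also have "\<dots> = (LINT y|?M A. (LINT t|lborel. ?P A y * (F ((override_on x y A)(a := t)) * h a t)))"
      unfolding ov P by (simp only: mult.left_commute)
    also have "\<dots> = (LINT y|?M A. ?P A y * G y)"
      by (simp add: G_def)
    finally show ?thesis by (simp only: mult.commute)
  qed
  \<comment> \<open>The pointwise error \<open>E\<close> is integrated against the kernels of
    \<open>A\<close>, each of L^1 norm at most \<open>L\<close>; this is the new summand with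
    exponent \<open>card A\<close>.\<close>
  have "\<bar>(LINT y|?M A. F (override_on x y A) * ?P A y) - (LINT y|?M A. G y * ?P A y)\<bar>
      = \<bar>LINT y|?M A. (F (override_on x y A) - G y) * ?P A y\<bar>"
    using int intG insert.hyps by (simp add: left_diff_distrib)
  also have "\<dots> \<le> (LINT y|?M A. E * (\<Prod>i\<in>A. \<bar>h i (y i)\<bar>))"
  proof -
    have "integrable (?M A) (\<lambda>y. (F (override_on x y A) - G y) * ?P A y)"
      using int intG insert.hyps by (simp add: left_diff_distrib)
    then have "integrable (?M A) (\<lambda>y. \<bar>(F (override_on x y A) - G y) * ?P A y\<bar>)"
      by (rule integrable_abs)
    moreover have "integrable (?M A) (\<lambda>y. E * (\<Prod>i\<in>A. \<bar>h i (y i)\<bar>))"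
      using insert.hyps h by (intro integrable_mult_right product_integrable_prod integrable_abs)
    moreover have "\<bar>(F (override_on x y A) - G y) * ?P A y\<bar> \<le> E * (\<Prod>i\<in>A. \<bar>h i (y i)\<bar>)" for y
      using G_approx[of y] by (simp add: abs_mult abs_prod mult_right_mono prod_nonneg)
    ultimately show ?thesis
      by (intro order_trans[OF integral_abs_bound] integral_mono)
  qed
  also have "\<dots> = E * (\<Prod>i\<in>A. LINT t|lborel. \<bar>h i t\<bar>)"
    using insert.hyps h product_integral_prod[of A "\<lambda>i t. \<bar>h i t\<bar>"] by simp
  also have "\<dots> \<le> E * (\<Prod>i\<in>A. L)"
    by (intro mult_left_mono prod_mono E conjI h_le) simp
  finally have "\<bar>(LINT y|?M A. F (override_on x y A) * ?P A y) - (LINT y|?M A. G y * ?P A y)\<bar>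
      \<le> E * L ^ card A" by simp
  with insert.IH insert.hyps show ?case
    unfolding step by (simp add: distrib_left)
qed

section \<open>Lebesgue measure on vectors as a product measure\<close>

lemma measurable_vec_lambda [measurable]:
  "vec_lambda \<in> measurable (Pi\<^sub>M UNIV (\<lambda>_. borel)) (borel :: (real ^ 'n) measure)"
proof (subst borel_measurable_euclidean_space, intro ballI)
  fix b :: "real ^ 'n" assume "b \<in> Basis"
  then obtain i where b: "b = axis i 1" by (auto simp: Basis_vec_def)
  show "(\<lambda>y. vec_lambda y \<bullet> b) \<in> borel_measurable (Pi\<^sub>M UNIV (\<lambda>_. borel))"
    unfolding b by (simp add: inner_axis)
qed

lemma prod_Basis_vec: "(\<Prod>b\<in>Basis. (v :: real ^ 'n) \<bullet> b) = (\<Prod>i\<in>UNIV. v $ i)"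
proof -
  have "(Basis :: (real ^ 'n) set) = range (\<lambda>i. axis i 1)" by (auto simp: Basis_vec_def)
  then have "(\<Prod>b\<in>Basis. v \<bullet> b) = (\<Prod>b\<in>range (\<lambda>i. axis i 1). v \<bullet> b)" by (rule arg_cong)
  also have "\<dots> = (\<Prod>i\<in>UNIV. v \<bullet> axis i 1)"
    by (subst prod.reindex) (auto simp: inj_def axis_eq_axis)
  finally show ?thesis by (simp add: inner_axis)
qed

text \<open>Open boxes pull back to product sets with the same volume, and these volumes
  characterise \<open>lborel\<close>. The lemma carries the tensor estimate, stated on functions,
  over to vectors.\<close>

lemma lborel_vec_eq_distr_PiM:
  "lborel = distr (Pi\<^sub>M UNIV (\<lambda>_. lborel)) borel (vec_lambda :: _ \<Rightarrow> real ^ 'n)"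
proof (rule lborel_eqI)
  fix l u :: "real ^ 'n" assume le: "\<And>b. b \<in> Basis \<Longrightarrow> l \<bullet> b \<le> u \<bullet> b"
  interpret product_sigma_finite "\<lambda>_::'n. lborel :: real measure" by standard
  have le': "l $ i \<le> u $ i" for i using le[of "axis i 1"] by (simp add: inner_axis)
  have [measurable]: "vec_lambda \<in> measurable (Pi\<^sub>M UNIV (\<lambda>_. lborel)) (borel :: (real ^ 'n) measure)"
    using measurable_vec_lambda by (simp cong: measurable_cong_sets sets_PiM_cong)
  have "vec_lambda -` box l u \<inter> space (Pi\<^sub>M UNIV (\<lambda>_. lborel)) = Pi\<^sub>E UNIV (\<lambda>i. {l $ i<..<u $ i})"
    by (auto simp: box_def Basis_vec_def inner_axis space_PiM PiE_iff)
  then have "emeasure (distr (Pi\<^sub>M UNIV (\<lambda>_. lborel)) borel vec_lambda) (box l u)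
     = emeasure (Pi\<^sub>M UNIV (\<lambda>_. lborel)) (Pi\<^sub>E UNIV (\<lambda>i. {l $ i<..<u $ i}))"
    by (simp add: emeasure_distr)
  also have "\<dots> = (\<Prod>i\<in>UNIV. ennreal (u $ i - l $ i))"
    using le' by (subst emeasure_PiM) auto
  also have "\<dots> = (\<Prod>b\<in>Basis. (u - l) \<bullet> b)"
    using le' by (subst prod_Basis_vec) (simp add: prod_ennreal)
  finally show "emeasure (distr (Pi\<^sub>M UNIV (\<lambda>_. lborel)) borel vec_lambda) (box l u)
     = (\<Prod>b\<in>Basis. (u - l) \<bullet> b)" .
qed simp

lemma lborel_distr_perm_vec:
  assumes "w permutes UNIV"
  shows "distr lborel borel (perm_vec w) = (lborel :: (real ^ 'n) measure)"
proof (rule lborel_eqI[symmetric])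
  fix l u :: "real ^ 'n" assume le: "\<And>b. b \<in> Basis \<Longrightarrow> l \<bullet> b \<le> u \<bullet> b"
  have le': "l $ i \<le> u $ i" for i using le[of "axis i 1"] by (simp add: inner_axis)
  have meas: "perm_vec w \<in> borel_measurable (borel :: (real ^ 'n) measure)"
    unfolding perm_vec_def[abs_def]
    by (intro borel_measurable_continuous_onI continuous_intros)
  have box: "v \<in> box p q \<longleftrightarrow> (\<forall>i. p $ i < v $ i \<and> v $ i < q $ i)" for v p q :: "real ^ 'n"
    by (auto simp: box_def Basis_vec_def inner_axis)
  have inv: "inv w permutes UNIV" using assms by (rule permutes_inv)
  have "perm_vec w -` box l u = box (perm_vec (inv w) l) (perm_vec (inv w) u)"
    using assms by (auto simp: box perm_vec_def) (metis permutes_inverses(1,2))+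
  then have "emeasure (distr lborel borel (perm_vec w)) (box l u)
      = emeasure lborel (box (perm_vec (inv w) l) (perm_vec (inv w) u))"
    using meas by (simp add: emeasure_distr)
  also have "\<dots> = (\<Prod>b\<in>Basis. (perm_vec (inv w) u - perm_vec (inv w) l) \<bullet> b)"
    using le' by (intro emeasure_lborel_box) (auto simp: Basis_vec_def inner_axis perm_vec_def)
  also have "(\<Prod>b\<in>Basis. (perm_vec (inv w) u - perm_vec (inv w) l) \<bullet> b)
      = (\<Prod>i\<in>UNIV. u $ (inv w i) - l $ (inv w i))"
    by (simp only: prod_Basis_vec) (simp add: perm_vec_def)
  also have "\<dots> = (\<Prod>i\<in>UNIV. u $ i - l $ i)"
    using inv by (rule prod.permute[symmetric, where g = "\<lambda>i. u $ i - l $ i", unfolded comp_def])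
  also have "\<dots> = (\<Prod>b\<in>Basis. (u - l) \<bullet> b)"
    by (simp only: prod_Basis_vec) simp
  finally show "emeasure (distr lborel borel (perm_vec w)) (box l u) = (\<Prod>b\<in>Basis. (u - l) \<bullet> b)" .
qed simp

section \<open>Sorting by permutations and the fundamental domain\<close>

text \<open>The index type is an abstract finite linear order; \<open>rank\<close> supplies
  positions at which a sorted list of indices can be read.\<close>

lemma finite_linorder_rank:
  fixes rank :: "'n::{finite,linorder} \<Rightarrow> nat"
  defines "rank \<equiv> \<lambda>i. card {j. j < i}"
  shows "mono rank" "bij_betw rank UNIV {..<CARD('n)}"
proof -
  have less: "rank i < rank j" if "i < j" for i j
    unfolding rank_def using that by (intro psubset_card_mono) auto
  then have "strict_mono rank" by (simp add: strict_mono_def)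
  then have inj: "inj rank" and "mono rank" by (auto intro: strict_mono_imp_inj_on strict_mono_mono)
  then show "mono rank" by simp
  have "rank ` UNIV = {..<CARD('n)}"
  proof (rule card_subset_eq)
    have "rank i < CARD('n)" for i
      unfolding rank_def by (intro psubset_card_mono) auto
    then show "rank ` UNIV \<subseteq> {..<CARD('n)}" by auto
  qed (use inj in \<open>simp_all add: card_image\<close>)
  with inj show "bij_betw rank UNIV {..<CARD('n)}" by (simp add: bij_betw_def)
qed

text \<open>The indices, not the entries, are sorted, with \<open>v\<close> as key; the reversed
  list read at \<open>rank i\<close> is then a bijection of the indices.\<close>

lemma ex_sorting_permutation:
  fixes v :: "'a::linorder ^ ('n::{finite,linorder})"
  obtains w where "w permutes UNIV" "\<And>i j. i \<le> j \<Longrightarrow> perm_vec w v $ j \<le> perm_vec w v $ i"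
proof -
  define rank where "rank = (\<lambda>i::'n. card {j. j < i})"
  have rank: "mono rank" "bij_betw rank UNIV {..<CARD('n)}"
    unfolding rank_def by (rule finite_linorder_rank)+
  obtain xs where xs: "set xs = (UNIV :: 'n set)" "distinct xs"
    using finite_distinct_list[of "UNIV :: 'n set"] by auto
  define ys where "ys = rev (sort_key (($) v) xs)"
  have ys: "set ys = UNIV" "distinct ys" using xs by (auto simp: ys_def)
  then have len: "length ys = CARD('n)" using distinct_card[of ys] by simp
  have sorted: "sorted (rev (map (($) v) ys))"
    by (simp add: ys_def rev_map)
  define w where "w = (\<lambda>i. ys ! rank i)"
  have "bij_betw (\<lambda>p. ys ! p) {..<CARD('n)} UNIV"
    using bij_betw_nth[of ys "{..<CARD('n)}" UNIV] ys len by simp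
  from bij_betw_trans[OF rank(2) this] have "bij w" by (simp add: w_def o_def)
  then have "w permutes UNIV" by (intro bij_imp_permutes) auto
  moreover have "perm_vec w v $ j \<le> perm_vec w v $ i" if "i \<le> j" for i j
  proof -
    have "rank i \<le> rank j" "rank j < length ys"
      using rank that len by (auto dest: monoD bij_betwE)
    then show ?thesis
      using sorted_rev_nth_mono[OF sorted, of "rank i" "rank j"] by (simp add: perm_vec_def w_def)
  qed
  ultimately show thesis by (rule that)
qed

text \<open>The superlevel sets of a decreasing vector are initial segments, so they are determined by
  their cardinalities, which a permutation does not change.\<close>

lemma decreasing_perm_vec_unique:
  fixes v :: "'a::linorder ^ ('n::{finite,linorder})"
  assumes w: "w permutes UNIV"
    and v: "\<And>i j. i \<le> j \<Longrightarrow> v $ j \<le> v $ i"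
    and wv: "\<And>i j. i \<le> j \<Longrightarrow> perm_vec w v $ j \<le> perm_vec w v $ i"
  shows "perm_vec w v = v"
proof -
  have eq: "{i. a \<le> perm_vec w v $ i} = {i. a \<le> v $ i}" (is "?A = ?B") for a
  proof -
    have "?A \<subseteq> ?B \<or> ?B \<subseteq> ?A"
    proof (rule ccontr)
      assume "\<not> ?thesis"
      then obtain i j where "i \<in> ?A" "i \<notin> ?B" "j \<in> ?B" "j \<notin> ?A" by blast
      then show False
        using v[of i j] wv[of j i] by (metis linear mem_Collect_eq order_trans)
    qed
    moreover have "?B = w ` ?A"
      using w by (auto simp: perm_vec_def image_iff) (metis permutes_inverses(1))
    then have "card ?A = card ?B"
      using w by (metis card_image permutes_inj_on)
    ultimately show ?thesis by (metis card_subset_eq finite)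
  qed
  show ?thesis
  proof (rule vec_eq_iff[THEN iffD2], rule allI, rule antisym)
    fix i
    show "perm_vec w v $ i \<le> v $ i" using eq[of "perm_vec w v $ i"] by blast
    show "v $ i \<le> perm_vec w v $ i" using eq[of "v $ i"] by blast
  qed
qed

text \<open>Since entry \<open>i\<close> of \<open>perm_vec w x\<close> is \<open>x $ w i\<close>,
  permutations act from the right. This fixes the order of composition in the orbit
  arguments.\<close>

lemma perm_vec_comp: "perm_vec (u \<circ> w) v = perm_vec w (perm_vec u v)"
  by (simp add: perm_vec_def vec_eq_iff)

lemma perm_vec_id [simp]: "perm_vec id v = v"
  by (simp add: perm_vec_def vec_eq_iff)

lemma perm_vec_inv:
  assumes "w permutes UNIV"
  shows "perm_vec w (perm_vec (inv w) v) = v" "perm_vec (inv w) (perm_vec w v) = v"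
  using permutes_inv_o[OF assms] by (simp_all add: perm_vec_comp[symmetric])

text \<open>Each orbit has at most one decreasing representative. It separates both the orbits of
  weights in \<open>P_plus\<close> and the permuted copies of the fundamental domain.\<close>

lemma decreasing_orbit_unique:
  fixes v v' :: "'a::linorder ^ ('n::{finite,linorder})"
  assumes w: "w permutes UNIV" "w' permutes UNIV" and eq: "perm_vec w v = perm_vec w' v'"
    and v: "\<And>i j. i \<le> j \<Longrightarrow> v $ j \<le> v $ i" and v': "\<And>i j. i \<le> j \<Longrightarrow> v' $ j \<le> v' $ i"
  shows "v = v'"
proof -
  have "v' = perm_vec (w \<circ> inv w') v"
    using perm_vec_inv(2)[OF w(2), of v'] by (simp add: perm_vec_comp eq)
  moreover have "w \<circ> inv w' permutes UNIV"
    by (intro permutes_compose permutes_inv w)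
  ultimately show ?thesis
    using decreasing_perm_vec_unique[of "w \<circ> inv w'" v] v v' by simp
qed

section \<open>Permutation orbits on the integer cube\<close>

definition box_upto :: "nat \<Rightarrow> (int ^ ('n::finite)) set" where
  "box_upto N = {k. \<forall>i. k $ i \<in> {0..int N}}"

lemma bij_betw_box_upto:
  "bij_betw vec_lambda (Pi\<^sub>E UNIV (\<lambda>_. {0..int N})) (box_upto N :: (int ^ ('n::finite)) set)"
  by (rule bij_betw_byWitness[where f' = vec_nth]) (auto simp: box_upto_def)

lemma finite_box_upto: "finite (box_upto N :: (int ^ ('n::finite)) set)"
  using bij_betw_finite[OF bij_betw_box_upto[of N, where 'n = 'n]] by (simp add: finite_PiE)

lemma P_plus_upto_subset_box: "P_plus_upto N \<subseteq> box_upto N"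
  by (auto simp: P_plus_upto_def P_plus_def box_upto_def)

lemma finite_P_plus_upto: "finite (P_plus_upto N)"
  using P_plus_upto_subset_box finite_box_upto by (rule finite_subset)

lemma card_stabG_pos: "card (stabG m) > 0"
proof -
  have "id \<in> stabG m" by (simp add: stabG_def permutes_id)
  moreover have "finite (stabG m)" by (rule finite_subset[OF _ finite_permutations[of UNIV]]) (auto simp: stabG_def)
  ultimately show ?thesis by (auto simp: card_gt_0_iff)
qed

text \<open>Orbit-stabilizer counting: the fibre of \<open>w \<mapsto> perm_vec w m\<close> over
  \<open>perm_vec w0 m\<close> is the coset of \<open>stabG m\<close> through \<open>w0\<close>, so
  every point of the orbit is hit equally often.\<close>

lemma sum_perm_vec_eq_sum_orbit:
  fixes m :: "int ^ ('n::finite)" and G :: "int ^ 'n \<Rightarrow> real"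
  shows "(\<Sum>w | w permutes UNIV. G (perm_vec w m))
    = real (card (stabG m)) * sum G ((\<lambda>w. perm_vec w m) ` {w. w permutes UNIV})"
proof -
  let ?S = "{w :: 'n \<Rightarrow> 'n. w permutes UNIV}" and ?f = "\<lambda>w. perm_vec w m"
  have fin: "finite ?S" by (rule finite_permutations) simp
  have card: "card {w \<in> ?S. ?f w = k} = card (stabG m)" if k: "k \<in> ?f ` ?S" for k
  proof -
    obtain w0 where w0: "w0 permutes UNIV" "k = perm_vec w0 m"
      using k by blast
    have "bij_betw (\<lambda>u. u \<circ> w0) (stabG m) {w \<in> ?S. ?f w = k}"
    proof (rule bij_betw_byWitness[where f' = "\<lambda>w. w \<circ> inv w0"])
      show "(\<lambda>w. w \<circ> inv w0) ` {w \<in> ?S. ?f w = k} \<subseteq> stabG m"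
        using w0 by (auto simp: stabG_def perm_vec_comp perm_vec_inv intro!: permutes_compose permutes_inv)
      show "(\<lambda>u. u \<circ> w0) ` stabG m \<subseteq> {w \<in> ?S. ?f w = k}"
        using w0 by (auto simp: stabG_def perm_vec_comp intro!: permutes_compose)
    qed (use permutes_inv_o[OF w0(1)] in \<open>auto simp: comp_assoc\<close>)
    then show ?thesis by (simp add: bij_betw_same_card)
  qed
  have "(\<Sum>w\<in>?S. G (?f w)) = (\<Sum>k\<in>?f ` ?S. \<Sum>w | w \<in> ?S \<and> ?f w = k. G (?f w))"
    using fin by (rule sum.image_gen)
  also have "\<dots> = (\<Sum>k\<in>?f ` ?S. real (card (stabG m)) * G k)"
    using card by (intro sum.cong) auto
  finally show ?thesis by (simp add: sum_distrib_left)
qed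

text \<open>Sorting shows that the cube is the disjoint union of the orbits of its dominant weights.
  Dividing by \<open>card (stabG m)\<close> undoes the multiplicity of the sum over all
  permutations.\<close>

lemma sum_box_upto_eq_sum_P_plus:
  fixes G :: "int ^ ('n::{finite,linorder}) \<Rightarrow> real"
  shows "sum G (box_upto N)
    = (\<Sum>m\<in>P_plus_upto N. (\<Sum>w | w permutes UNIV. G (perm_vec w m)) / real (card (stabG m)))"
proof -
  let ?orb = "\<lambda>m::int^('n::_). (\<lambda>w. perm_vec w m) ` {w. w permutes UNIV}"
  have "box_upto N = (\<Union>m\<in>P_plus_upto N. ?orb m)"
  proof (intro set_eqI iffI)
    fix k :: "int ^ ('n::_)" assume k: "k \<in> box_upto N"
    obtain w where w: "w permutes UNIV" "\<And>i j. i \<le> j \<Longrightarrow> perm_vec w k $ j \<le> perm_vec w k $ i"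
      using ex_sorting_permutation[of k] by blast
    have "perm_vec w k \<in> P_plus_upto N"
      using k w(2) by (auto simp: P_plus_upto_def P_plus_def box_upto_def perm_vec_def)
    moreover have "k = perm_vec (inv w) (perm_vec w k)" using w by (simp add: perm_vec_inv)
    ultimately show "k \<in> (\<Union>m\<in>P_plus_upto N. ?orb m)"
      using permutes_inv[OF w(1)] by blast
  next
    fix k :: "int ^ ('n::_)" assume "k \<in> (\<Union>m\<in>P_plus_upto N. ?orb m)"
    then show "k \<in> box_upto N"
      by (auto simp: P_plus_upto_def P_plus_def box_upto_def perm_vec_def)
  qed
  moreover have "?orb m \<inter> ?orb m' = {}" if "m \<in> P_plus_upto N" "m' \<in> P_plus_upto N" "m \<noteq> m'" for m m'
    using that decreasing_orbit_unique[of _ _ m m'] by (auto simp: P_plus_upto_def P_plus_def)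
  ultimately have "sum G (box_upto N) = (\<Sum>m\<in>P_plus_upto N. sum G (?orb m))"
    by (simp add: sum.UNION_disjoint finite_P_plus_upto finite_permutations)
  moreover have "stabG m \<noteq> {}" for m :: "int ^ ('n::_)"
    using card_stabG_pos[of m] by auto
  ultimately show ?thesis by (simp add: sum_perm_vec_eq_sum_orbit)
qed

section \<open>Tiling the half cube by permuted copies of the fundamental domain\<close>

definition half_cube :: "(real ^ ('n::finite)) set" where
  "half_cube = {x. \<forall>i. x $ i \<in> {0..1/2}}"

lemma half_cube_eq_cbox: "half_cube = cbox 0 (\<chi> i. 1/2)"
  by (auto simp: half_cube_def mem_box_cart)

text \<open>An upper bound suffices for the tiling: points of this set outside \<open>fundF\<close>
  have a repeated coordinate or one equal to 0 or 1/2, and they form a null set.\<close>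

lemma closure_fundF_subset:
  "closure fundF \<subseteq> {x \<in> half_cube. \<forall>i j. i \<le> j \<longrightarrow> x $ j \<le> x $ i}"
proof (rule closure_minimal)
  show "fundF \<subseteq> {x \<in> half_cube. \<forall>i j. i \<le> j \<longrightarrow> x $ j \<le> x $ i}"
    by (auto simp: fundF_def half_cube_def less_imp_le le_less)
  have "{x \<in> half_cube. \<forall>i j. i \<le> j \<longrightarrow> x $ j \<le> x $ i}
      = half_cube \<inter> (\<Inter>i. \<Inter>j\<in>{i..}. {x. x $ j \<le> x $ i})" by auto
  also have "closed \<dots>"
    unfolding half_cube_eq_cbox
    by (intro closed_Int closed_cbox closed_INT ballI closed_Collect_le continuous_intros)
  finally show "closed {x \<in> half_cube. \<forall>i j. i \<le> j \<longrightarrow> x $ j \<le> x $ i}" .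
qed

lemma AE_lborel_coordinate_neq:
  "AE x in lborel. (x :: real ^ 'n) $ i \<noteq> c"
  "i \<noteq> j \<Longrightarrow> AE x in lborel. (x :: real ^ 'n) $ i \<noteq> x $ j"
proof -
  have *: "AE x in lborel. a \<bullet> (x :: real ^ 'n) \<noteq> b" if "a \<noteq> 0" for a b
  proof -
    have "{x. a \<bullet> x = b} \<in> null_sets (completion lborel)"
      using negligible_hyperplane[of a b] that by (simp add: negligible_iff_null_sets)
    moreover have "{x. a \<bullet> x = b} \<in> sets lborel" by (simp add: closed_hyperplane borel_closed)
    ultimately have "{x. a \<bullet> x = b} \<in> null_sets lborel" by (simp add: null_sets_completion_iff)
    then show ?thesis by (rule AE_I'[of "{x. a \<bullet> x = b}"]) auto
  qed
  show "AE x in lborel. (x :: real ^ 'n) $ i \<noteq> c"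
    using *[of "axis i 1" c] by (simp add: inner_axis' axis_eq_0_iff)
  assume ij: "i \<noteq> j"
  then have "axis i 1 - axis j (1::real) \<noteq> 0" by (simp add: axis_eq_axis)
  from *[OF this, of 0] show "AE x in lborel. (x :: real ^ 'n) $ i \<noteq> x $ j"
    by (simp add: inner_diff_left inner_axis')
qed

text \<open>Almost every point has distinct coordinates different from 0 and 1/2, and then exactly
  one permutation sorts it. As a sum of indicators, the tiling can be inserted directly under an
  integral.\<close>

lemma sum_indicator_closure_fundF:
  "AE x in lborel. (\<Sum>w | w permutes UNIV. indicator (closure fundF) (perm_vec w x))
    = (indicator half_cube (x :: real ^ ('n::{finite,linorder})) :: real)"
proof -
  have "AE x in lborel. \<forall>i. (x :: real ^ ('n::_)) $ i \<noteq> 0 \<and> x $ i \<noteq> 1/2 \<and> (\<forall>j. i \<noteq> j \<longrightarrow> x $ i \<noteq> x $ j)"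
    unfolding AE_all_countable AE_conj_iff
    by (intro allI conjI AE_lborel_coordinate_neq AE_impI) simp
  then show ?thesis
  proof eventually_elim
    case (elim x)
    show ?case
    proof (cases "x \<in> half_cube")
      case False
      have "perm_vec w x \<notin> closure fundF" if w: "w permutes UNIV" for w
      proof
        assume "perm_vec w x \<in> closure fundF"
        then have "perm_vec w x $ inv w i \<in> {0..1/2}" for i
          using closure_fundF_subset by (auto simp: half_cube_def)
        then have "x \<in> half_cube"
          using permutes_inverses(1)[OF w] by (simp add: half_cube_def perm_vec_def)
        with False show False by simp
      qed
      with False show ?thesis by (simp add: sum.neutral)
    next
      case True
      obtain w where w: "w permutes UNIV" "\<And>i j. i \<le> j \<Longrightarrow> perm_vec w x $ j \<le> perm_vec w x $ i"
        using ex_sorting_permutation[of x] by blast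
      have "perm_vec w x \<in> fundF"
      proof -
        have "perm_vec w x $ j < perm_vec w x $ i" if "i < j" for i j
        proof -
          have "w i \<noteq> w j" using that injD[OF permutes_inj[OF w(1)], of i j] by auto
          then have "x $ w i \<noteq> x $ w j" using elim by blast
          then show ?thesis using w(2)[OF less_imp_le[OF that]] by (simp add: perm_vec_def)
        qed
        moreover have "0 < x $ i \<and> x $ i < 1/2" for i
          using True elim[rule_format, of i] by (auto simp: half_cube_def less_le)
        ultimately show ?thesis by (simp add: fundF_def perm_vec_def)
      qed
      then have in_w: "perm_vec w x \<in> closure fundF" using closure_subset by blast
      \<comment> \<open>Both sorted vectors lie in the orbit of \<open>x\<close> and hence agree;
        the distinct coordinates of \<open>x\<close> then identify the permutations.\<close>
      have "u = w" if u: "u permutes UNIV" "perm_vec u x \<in> closure fundF" for u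
      proof -
        have "perm_vec u x = perm_vec w x"
        proof (rule decreasing_orbit_unique[of "inv u" "inv w"])
          show "\<And>i j. i \<le> j \<Longrightarrow> perm_vec u x $ j \<le> perm_vec u x $ i"
            using u(2) closure_fundF_subset by blast
          show "perm_vec (inv u) (perm_vec u x) = perm_vec (inv w) (perm_vec w x)"
            by (simp add: perm_vec_inv u(1) w(1))
        qed (rule permutes_inv[OF u(1)] permutes_inv[OF w(1)] w(2), assumption?)+
        then have "x $ u i = x $ w i" for i by (simp add: perm_vec_def vec_eq_iff)
        then have "u i = w i" for i using elim by metis
        then show ?thesis by auto
      qed
      then have "(\<Sum>u | u permutes UNIV. indicator (closure fundF) (perm_vec u x))
          = (\<Sum>u | u permutes UNIV. if u = w then 1 else (0::real))"
        using in_w by (intro sum.cong refl) (auto simp only: indicator_def mem_Collect_eq of_bool_def split: if_split)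
      also have "\<dots> = 1" using w by (simp add: finite_permutations)
      finally show ?thesis using True by simp
    qed
  qed
qed

lemma borel_measurable_perm_vec [measurable]:
  "perm_vec w \<in> borel_measurable (borel :: (real ^ ('n::finite)) measure)"
  unfolding perm_vec_def[abs_def] by (intro borel_measurable_continuous_onI continuous_intros)

lemma
  fixes g :: "real ^ ('n::finite) \<Rightarrow> real"
  assumes "w permutes UNIV" "g \<in> borel_measurable borel"
  shows integrable_perm_vec: "integrable lborel (\<lambda>x. g (perm_vec w x)) \<longleftrightarrow> integrable lborel g"
    and integral_perm_vec: "(LINT x|lborel. g (perm_vec w x)) = (LINT x|lborel. g x)"
  using assms(2) integrable_distr_eq[of "perm_vec w" lborel borel g] integral_distr[of "perm_vec w" lborel borel g]
  by (simp_all add: lborel_distr_perm_vec[OF assms(1)])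

text \<open>By symmetry of \<open>h\<close> and invariance of the measure, all n! tiles contribute
  equally.\<close>

lemma integral_closure_fundF:
  fixes h :: "real ^ ('n::{finite,linorder}) \<Rightarrow> real"
  assumes sym: "\<And>w x. w permutes UNIV \<Longrightarrow> h (perm_vec w x) = h x"
    and [measurable]: "h \<in> borel_measurable borel"
    and int: "set_integrable lborel half_cube h"
  shows "(LINT x:half_cube|lborel. h x) = fact CARD('n) * (LINT x:closure fundF|lborel. h x)"
proof -
  let ?S = "{w :: 'n \<Rightarrow> 'n. w permutes UNIV}"
  let ?g = "\<lambda>x. indicator (closure fundF) x * h x"
  have [measurable]: "closure fundF \<in> sets (borel :: (real ^ ('n::_)) measure)" by (simp add: borel_closed)
  have [measurable]: "half_cube \<in> sets (borel :: (real ^ ('n::_)) measure)" by (simp add: half_cube_eq_cbox)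
  have "set_integrable lborel (closure fundF) h"
    using int closure_fundF_subset by (elim set_integrable_subset) auto
  then have intg: "integrable lborel ?g" by (simp add: set_integrable_def)
  have "(LINT x:half_cube|lborel. h x) = (LINT x|lborel. indicator half_cube x * h x)"
    by (simp add: set_lebesgue_integral_def)
  also have "\<dots> = (LINT x|lborel. (\<Sum>w\<in>?S. ?g (perm_vec w x)))"
  proof (rule integral_cong_AE)
    show "AE x in lborel. indicator half_cube x * h x = (\<Sum>w\<in>?S. ?g (perm_vec w x))"
      using sum_indicator_closure_fundF
    proof eventually_elim
      case (elim x)
      have "(\<Sum>w\<in>?S. ?g (perm_vec w x)) = (\<Sum>w\<in>?S. indicator (closure fundF) (perm_vec w x)) * h x"
        by (simp add: sum_distrib_right sym)
      then show ?case by (simp add: elim)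
    qed
  qed measurable
  also have "\<dots> = (\<Sum>w\<in>?S. (LINT x|lborel. ?g (perm_vec w x)))"
    using intg by (intro Bochner_Integration.integral_sum) (simp add: integrable_perm_vec[where g = ?g])
  also have "\<dots> = (\<Sum>w\<in>?S. (LINT x|lborel. ?g x))"
    by (intro sum.cong refl integral_perm_vec) auto
  also have "\<dots> = fact CARD('n) * (LINT x|lborel. ?g x)"
    using card_permutations[of "UNIV :: 'n set"] by simp
  finally show ?thesis by (simp add: set_lebesgue_integral_def)
qed

section \<open>Multidimensional cosine sums\<close>

lemma set_lebesgue_integral_sum:
  fixes g :: "'i \<Rightarrow> 'a \<Rightarrow> real"
  assumes "\<And>i. i \<in> I \<Longrightarrow> set_integrable M A (g i)"
  shows "(LINT x:A|M. (\<Sum>i\<in>I. g i x)) = (\<Sum>i\<in>I. (LINT x:A|M. g i x))"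
  using assms Bochner_Integration.integral_sum[of I M "\<lambda>i x. indicator A x *\<^sub>R g i x"]
  by (simp add: set_lebesgue_integral_def set_integrable_def sum_distrib_left)

definition cos_prod :: "int ^ 'n \<Rightarrow> real ^ ('n::finite) \<Rightarrow> real" where
  "cos_prod k x = (\<Prod>j\<in>UNIV. cos (2 * pi * real_of_int (k $ j) * x $ j))"

definition cos_coeff :: "(real ^ ('n::finite) \<Rightarrow> real) \<Rightarrow> int ^ 'n \<Rightarrow> real" where
  "cos_coeff f k = (LINT x:half_cube|lborel. f x * cos_prod k x)"

lemma continuous_on_cos_prod [continuous_intros]: "continuous_on S (cos_prod k)"
  unfolding cos_prod_def by (intro continuous_intros)

lemma cos_plus_eq_sum: "cos_plus m x = (\<Sum>w | w permutes UNIV. cos_prod (perm_vec w m) x)"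
  by (simp add: cos_plus_def cos_prod_def perm_vec_def)

lemma cos_prod_perm_vec:
  assumes "w permutes UNIV"
  shows "cos_prod (perm_vec w k) (perm_vec w x) = cos_prod k x"
  unfolding cos_prod_def perm_vec_def
  using prod.permute[OF assms, of "\<lambda>j. cos (2 * pi * real_of_int (k $ j) * x $ j)"]
  by (simp add: o_def)

lemma half_cube_perm_vec:
  assumes "w permutes UNIV"
  shows "perm_vec w x \<in> half_cube \<longleftrightarrow> x \<in> half_cube"
  using permutes_inverses(1)[OF assms] by (auto simp: half_cube_def perm_vec_def) (metis+)

lemma set_integrable_half_cube:
  fixes g :: "real ^ ('n::finite) \<Rightarrow> real"
  assumes "continuous_on UNIV g"
  shows "set_integrable lborel half_cube g"
  unfolding half_cube_eq_cbox set_integrable_def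
  using assms by (intro borel_integrable_compact continuous_on_subset[OF assms]) auto

lemma zeros_perm_vec:
  assumes "w permutes UNIV"
  shows "zeros (perm_vec w m) = zeros m"
proof -
  have "bij_betw w {i. perm_vec w m $ i = 0} {i. m $ i = 0}"
    by (rule bij_betw_byWitness[where f' = "inv w"])
      (use permutes_inverses[OF assms] in \<open>auto simp: perm_vec_def\<close>)
  then show ?thesis by (simp add: zeros_def bij_betw_same_card)
qed

lemma cos_coeff_perm_vec:
  fixes f :: "real ^ ('n::finite) \<Rightarrow> real"
  assumes w: "w permutes UNIV" and sym: "\<And>x. f (perm_vec w x) = f x"
    and cont: "continuous_on UNIV f"
  shows "cos_coeff f (perm_vec w k) = cos_coeff f k"
proof -
  let ?g = "\<lambda>x. indicator half_cube x * (f x * cos_prod (perm_vec w k) x)"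
  have "?g \<in> borel_measurable borel"
  proof -
    have [measurable]: "half_cube \<in> sets (borel :: (real ^ 'n) measure)" by (simp add: half_cube_eq_cbox)
    have [measurable]: "(\<lambda>x. f x * cos_prod (perm_vec w k) x) \<in> borel_measurable borel"
      by (intro borel_measurable_continuous_onI continuous_intros cont)
    show ?thesis by measurable
  qed
  from integral_perm_vec[OF w this] show ?thesis
    using w by (simp add: cos_coeff_def set_lebesgue_integral_def sym cos_prod_perm_vec
        half_cube_perm_vec indicator_def)
qed

lemma integral_half_cube_cos_plus:
  fixes f :: "real ^ ('n::finite) \<Rightarrow> real"
  assumes sym: "\<And>w x. w permutes UNIV \<Longrightarrow> f (perm_vec w x) = f x"
    and cont: "continuous_on UNIV f"
  shows "(LINT x:half_cube|lborel. f x * cos_plus m x) = fact CARD('n) * cos_coeff f m"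
proof -
  have int: "set_integrable lborel half_cube (\<lambda>x. f x * cos_prod (perm_vec w m) x)" for w
    by (intro set_integrable_half_cube continuous_intros cont)
  have "(LINT x:half_cube|lborel. f x * cos_plus m x)
      = (\<Sum>w | w permutes UNIV. cos_coeff f (perm_vec w m))"
    unfolding cos_plus_eq_sum sum_distrib_left cos_coeff_def
    by (rule set_lebesgue_integral_sum) (rule int)
  also have "\<dots> = (\<Sum>w | w permutes (UNIV :: 'n set). cos_coeff f m)"
    using sym cont by (intro sum.cong) (auto simp: cos_coeff_perm_vec)
  finally show ?thesis using card_permutations[of "UNIV :: 'n set"] by simp
qed

section \<open>Kernel expansion and uniform error of the cubic partial sums\<close>

lemma sum_int_atLeastAtMost: "(\<Sum>k\<in>{0..int N}. g k) = g 0 + (\<Sum>k=1..N. g (int k))"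
proof (induction N)
  case (Suc N)
  have "{0..int (Suc N)} = insert (int (Suc N)) {0..int N}" by auto
  with Suc.IH show ?case by (simp add: add_ac)
qed simp

text \<open>The two constant terms 1 add up to 2, while each positive frequency gives 2 (cos(u-v) +
  cos(u+v)) = 4 cos u cos v. The divisor for \<open>k = 0\<close> becomes \<open>2 ^ zeros k\<close>
  after multiplying over coordinates.\<close>

lemma cos_kernel_eq_sum:
  "cos_kernel N x t = (\<Sum>k\<in>{0..int N}. (4 / (if k = 0 then 2 else 1)) * cos (2 * pi * real_of_int k * x)
      * (indicator {0..1/2} t * cos (2 * pi * real_of_int k * t)))"
proof -
  have "dirichlet N (x - t) + dirichlet N (x + t)
      = 2 + (\<Sum>k=1..N. 4 * cos (2 * pi * real k * x) * cos (2 * pi * real k * t))"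
    by (simp add: dirichlet_def right_diff_distrib distrib_left cos_add cos_diff
        sum.distrib[symmetric] sum_distrib_left mult_ac)
  then show ?thesis
    unfolding sum_int_atLeastAtMost by (simp add: cos_kernel_def mult.assoc)
qed

lemma prod_cos_kernel:
  fixes x y :: "real ^ ('n::finite)"
  shows "(\<Prod>i\<in>UNIV. cos_kernel N (x $ i) (y $ i)) = (\<Sum>k\<in>box_upto N.
      2 ^ (2 * CARD('n)) / 2 ^ zeros k * cos_prod k x * (indicator half_cube y * cos_prod k y))"
proof -
  let ?t = "\<lambda>i k. (4 / (if k = 0 then 2 else 1)) * cos (2 * pi * real_of_int k * x $ i)
      * (indicator {0..1/2} (y $ i) * cos (2 * pi * real_of_int k * y $ i))"
  have "(\<Prod>i\<in>UNIV. cos_kernel N (x $ i) (y $ i))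
      = (\<Sum>g\<in>Pi\<^sub>E UNIV (\<lambda>_. {0..int N}). \<Prod>i\<in>UNIV. ?t i (g i))"
    unfolding cos_kernel_eq_sum by (rule prod_sum_PiE) auto
  also have "\<dots> = (\<Sum>g\<in>Pi\<^sub>E UNIV (\<lambda>_. {0..int N}). \<Prod>i\<in>UNIV. ?t i (vec_lambda g $ i))"
    by simp
  also have "\<dots> = (\<Sum>k\<in>box_upto N. \<Prod>i\<in>UNIV. ?t i (k $ i))"
    by (rule sum.reindex_bij_betw[OF bij_betw_box_upto])
  also have "\<dots> = (\<Sum>k\<in>box_upto N.
      2 ^ (2 * CARD('n)) / 2 ^ zeros k * cos_prod k x * (indicator half_cube y * cos_prod k y))"
  proof (intro sum.cong refl)
    fix k :: "int ^ 'n"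
    have "(\<Prod>i\<in>UNIV. if k $ i = 0 then 2 else 1 :: real) = 2 ^ zeros k"
      by (simp add: prod.If_cases zeros_def)
    then have "(\<Prod>i\<in>UNIV. 4 / (if k $ i = 0 then 2 else 1 :: real)) = 2 ^ (2 * CARD('n)) / 2 ^ zeros k"
      by (simp add: prod_dividef power_mult)
    moreover have "(\<Prod>i\<in>UNIV. indicator {0..1/2} (y $ i) :: real) = indicator half_cube y"
      by (auto simp: indicator_def half_cube_def)
    ultimately show "(\<Prod>i\<in>UNIV. ?t i (k $ i))
      = 2 ^ (2 * CARD('n)) / 2 ^ zeros k * cos_prod k x * (indicator half_cube y * cos_prod k y)"
      by (simp only: prod.distrib cos_prod_def)
  qed
  finally show ?thesis .
qed

definition cos_partial_sum :: "(real ^ ('n::finite) \<Rightarrow> real) \<Rightarrow> nat \<Rightarrow> real ^ 'n \<Rightarrow> real" where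
  "cos_partial_sum f N x =
     (\<Sum>k\<in>box_upto N. 2 ^ (2 * CARD('n)) / 2 ^ zeros k * cos_coeff f k * cos_prod k x)"

lemma integral_prod_cos_kernel:
  fixes f :: "real ^ ('n::finite) \<Rightarrow> real"
  assumes cont: "continuous_on UNIV f"
  shows "(LINT y|lborel. f y * (\<Prod>i\<in>UNIV. cos_kernel N (x $ i) (y $ i))) = cos_partial_sum f N x"
proof -
  let ?c = "\<lambda>k. 2 ^ (2 * CARD('n)) / 2 ^ zeros k * cos_prod k x"
  have int: "integrable lborel (\<lambda>y. indicator half_cube y * (f y * cos_prod k y))" for k
    using set_integrable_half_cube[OF continuous_on_mult[OF cont continuous_on_cos_prod], of k]
    by (simp add: set_integrable_def)
  have "f y * (\<Prod>i\<in>UNIV. cos_kernel N (x $ i) (y $ i))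
      = (\<Sum>k\<in>box_upto N. ?c k * (indicator half_cube y * (f y * cos_prod k y)))" for y
    unfolding prod_cos_kernel sum_distrib_left by (intro sum.cong) auto
  then have "(LINT y|lborel. f y * (\<Prod>i\<in>UNIV. cos_kernel N (x $ i) (y $ i)))
      = (LINT y|lborel. (\<Sum>k\<in>box_upto N. ?c k * (indicator half_cube y * (f y * cos_prod k y))))"
    by simp
  also have "\<dots> = (\<Sum>k\<in>box_upto N. ?c k * cos_coeff f k)"
    using int by (simp add: Bochner_Integration.integral_sum cos_coeff_def set_lebesgue_integral_def)
  finally show ?thesis by (simp add: cos_partial_sum_def mult_ac)
qed

text \<open>The bound of \<open>tensor_kernel_approximates\<close> with \<open>E\<close> taken from
  \<open>cos_kernel_approximates\<close> and \<open>L\<close> from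
  \<open>integral_abs_cos_kernel\<close>.\<close>

definition cos_error :: "nat \<Rightarrow> real \<Rightarrow> nat \<Rightarrow> real" where
  "cos_error n B N = 3 * B / sqrt (real N) * (\<Sum>k<n. (4 * ln (2 * real N + 2)) ^ k)"

lemma cos_error_tendsto_0: "cos_error n B \<longlonglongrightarrow> 0"
proof -
  have "(\<lambda>N. (4 * ln (2 * real N + 2)) ^ k / sqrt (real N)) \<longlonglongrightarrow> 0" for k
    by real_asymp
  then have "(\<lambda>N. 3 * B * (\<Sum>k<n. (4 * ln (2 * real N + 2)) ^ k / sqrt (real N))) \<longlonglongrightarrow> 3 * B * (\<Sum>k<n. 0)"
    by (intro tendsto_intros)
  then show ?thesis
    by (simp add: cos_error_def[abs_def] sum_divide_distrib[symmetric])
qed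

text \<open>Fractional parts move every point into the compact unit cube. The approximation lemmas
  ask for bounds on all of space, and this supplies them for \<open>f\<close> and for its partial
  derivatives.\<close>

lemma bounded_if_periodic:
  fixes g :: "real ^ ('n::finite) \<Rightarrow> real"
  assumes cont: "continuous_on UNIV g" and per: "\<And>x r. g (x + int_vec r) = g x"
  obtains b where "\<And>x. \<bar>g x\<bar> \<le> b"
proof -
  have "compact (g ` cbox 0 (\<chi> i. 1))"
    by (intro compact_continuous_image continuous_on_subset[OF cont]) auto
  then obtain b where b: "\<And>x. x \<in> cbox 0 (\<chi> i. 1) \<Longrightarrow> \<bar>g x\<bar> \<le> b"
    using compact_imp_bounded[of "g ` cbox 0 (\<chi> i. 1)"] by (auto simp: bounded_iff)
  have "\<bar>g x\<bar> \<le> b" for x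
  proof -
    have "(\<chi> i. frac (x $ i)) + int_vec (\<chi> i. \<lfloor>x $ i\<rfloor>) = x"
      by (simp add: int_vec_def vec_eq_iff frac_def)
    then have "g x = g (\<chi> i. frac (x $ i))" using per by metis
    moreover have "(\<chi> i. frac (x $ i)) \<in> cbox 0 (\<chi> i. 1)"
      by (simp add: mem_box_cart less_imp_le[OF frac_lt_1])
    ultimately show ?thesis using b by simp
  qed
  then show thesis by (rule that)
qed

lemma cos_partial_sum_error:
  fixes f :: "real ^ ('n::finite) \<Rightarrow> real"
  assumes cont: "continuous_on UNIV f" and f_bound: "\<And>x. \<bar>f x\<bar> \<le> b"
    and g_cont: "\<And>i. continuous_on UNIV (g i)" and g_bound: "\<And>i x. \<bar>g i x\<bar> \<le> B"
    and deriv: "\<And>i x. ((\<lambda>t. f (x + t *\<^sub>R axis i 1)) has_real_derivative g i x) (at 0)"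
    and x: "x \<in> half_cube" and N: "0 < N"
  shows "\<bar>f x - cos_partial_sum f N x\<bar> \<le> cos_error CARD('n) B N"
proof -
  let ?h = "\<lambda>i. cos_kernel N (x $ i)"
  have meas: "f \<in> borel_measurable borel" using cont by (rule borel_measurable_continuous_onI)
  have [measurable]: "(\<lambda>y. f (vec_lambda y)) \<in> borel_measurable (Pi\<^sub>M UNIV (\<lambda>_. borel))"
    by (rule measurable_compose[OF measurable_vec_lambda meas])
  have "\<bar>f (vec_lambda (vec_nth x)) - (LINT y|Pi\<^sub>M UNIV (\<lambda>_. lborel).
      f (vec_lambda (override_on (vec_nth x) y UNIV)) * (\<Prod>i\<in>UNIV. ?h i (y i)))\<bar>
    \<le> 3 * B / sqrt (real N) * (\<Sum>k<card (UNIV :: 'n set). (4 * ln (2 * real N + 2)) ^ k)"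
  proof (rule tensor_kernel_approximates)
    show "integrable lborel (?h i)" for i by (rule integrable_cos_kernel)
    show "(LINT t|lborel. \<bar>?h i t\<bar>) \<le> 4 * ln (2 * real N + 2)" for i
      using x by (intro integral_abs_cos_kernel) (auto simp: half_cube_def)
    fix i and z :: "'n \<Rightarrow> real" assume z: "z i = x $ i"
    \<comment> \<open>The line through \<open>z\<close> parallel to axis \<open>i\<close>. Resetting
      the entry \<open>i\<close> to 0 first makes the parameter \<open>t\<close> equal to that
      coordinate.\<close>
    define v where "v t = vec_lambda (z(i := 0)) + t *\<^sub>R axis i (1::real)" for t
    have v: "vec_lambda (z(i := t)) = v t" for t
      by (simp add: v_def vec_eq_iff axis_def)
    have "\<bar>f (v (x $ i)) - (LINT t|lborel. f (v t) * ?h i t)\<bar> \<le> 3 * B / sqrt (real N)"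
    proof (rule cos_kernel_approximates[where g' = "\<lambda>t. g i (v t)"])
      fix t
      have "v t + s *\<^sub>R axis i 1 = v (s + t)" for s
        by (simp add: v_def algebra_simps)
      then have "((\<lambda>s. f (v (s + t))) has_real_derivative g i (v t)) (at 0)"
        using deriv[of "v t" i] by simp
      then show "((\<lambda>t. f (v t)) has_real_derivative g i (v t)) (at t)"
        using DERIV_shift[of "\<lambda>t. f (v t)" "g i (v t)" 0 t] by simp
    next
      show "continuous_on UNIV (\<lambda>t. g i (v t))"
        unfolding v_def by (intro continuous_on_compose2[OF g_cont] continuous_intros) auto
    qed (use x N g_bound in \<open>auto simp: half_cube_def\<close>)
    moreover have "vec_lambda z = v (x $ i)"
      using v[of "x $ i"] z by (simp add: fun_upd_idem)
    ultimately show "\<bar>f (vec_lambda z) - (LINT t|lborel. f (vec_lambda (z(i := t))) * ?h i t)\<bar>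
        \<le> 3 * B / sqrt (real N)" by (simp add: v)
  qed (use f_bound in auto)
  moreover have "(LINT y|Pi\<^sub>M UNIV (\<lambda>_. lborel).
      f (vec_lambda (override_on (vec_nth x) y UNIV)) * (\<Prod>i\<in>UNIV. ?h i (y i)))
      = (LINT y|lborel. f y * (\<Prod>i\<in>UNIV. ?h i (y $ i)))"
  proof -
    have "vec_lambda \<in> measurable (Pi\<^sub>M UNIV (\<lambda>_. lborel)) (borel :: (real ^ 'n) measure)"
      using measurable_vec_lambda by (simp cong: measurable_cong_sets sets_PiM_cong)
    moreover have "(\<lambda>y. f y * (\<Prod>i\<in>UNIV. ?h i (y $ i))) \<in> borel_measurable borel"
      using meas by measurable
    ultimately show ?thesis
      by (subst lborel_vec_eq_distr_PiM) (simp add: integral_distr override_on_def)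
  qed
  ultimately show ?thesis
    unfolding integral_prod_cos_kernel[OF cont] by (simp add: cos_error_def vec_nth_inverse)
qed

section \<open>Summation over the dominant weights\<close>

lemma P_plus_upto_tendsto:
  "filterlim (P_plus_upto :: nat \<Rightarrow> (int ^ ('n::{finite,linorder})) set)
    (finite_subsets_at_top P_plus) sequentially"
  unfolding filterlim_finite_subsets_at_top
proof (intro allI impI)
  fix X :: "(int ^ ('n::_)) set" assume X: "finite X \<and> X \<subseteq> P_plus"
  define M where "M = Max (insert 0 ((\<lambda>p. nat (fst p $ snd p)) ` (X \<times> UNIV)))"
  have "m $ i \<le> int N" if "m \<in> X" "M \<le> N" for m i N
  proof -
    have "nat (m $ i) \<le> M"
      unfolding M_def using X that by (intro Max_ge) (auto intro!: image_eqI[of _ _ "(m, i)"])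
    then show ?thesis using that by linarith
  qed
  then have "finite (P_plus_upto N) \<and> X \<subseteq> P_plus_upto N \<and> P_plus_upto N \<subseteq> P_plus" if "M \<le> N" for N
    using X that finite_P_plus_upto[of N] by (auto simp: P_plus_upto_def)
  then show "\<forall>\<^sub>F N in sequentially. finite (P_plus_upto N) \<and> X \<subseteq> P_plus_upto N \<and> P_plus_upto N \<subseteq> P_plus"
    by (rule eventually_sequentiallyI)
qed

text \<open>Every finite subset of \<open>P_plus\<close> lies in some \<open>P_plus_upto N\<close>,
  so for nonnegative terms the limit \<open>s\<close> bounds all finite sums. The unordered sum
  therefore exists, and evaluating it along the cubes identifies it with \<open>s\<close>.\<close>

lemma has_sum_P_plus:
  fixes t :: "int ^ ('n::{finite,linorder}) \<Rightarrow> real"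
  assumes nonneg: "\<And>m. 0 \<le> t m" and lim: "(\<lambda>N. sum t (P_plus_upto N)) \<longlonglongrightarrow> s"
  shows "(t has_sum s) P_plus"
proof -
  have "incseq (\<lambda>N. sum t (P_plus_upto N))"
  proof (intro incseq_SucI sum_mono2 finite_P_plus_upto nonneg)
    show "P_plus_upto N \<subseteq> P_plus_upto (Suc N)" for N
      by (auto simp: P_plus_upto_def intro: order_trans)
  qed
  then have le: "sum t (P_plus_upto N) \<le> s" for N using lim by (rule incseq_le)
  have "t summable_on P_plus"
  proof (rule nonneg_bdd_above_summable_on)
    show "bdd_above (sum t ` {F. F \<subseteq> P_plus \<and> finite F})"
    proof (rule bdd_aboveI2)
      fix X assume X: "X \<in> {F. F \<subseteq> (P_plus :: (int ^ ('n::_)) set) \<and> finite F}"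
      then have "\<forall>\<^sub>F N in sequentially. X \<subseteq> P_plus_upto N"
        using P_plus_upto_tendsto unfolding filterlim_finite_subsets_at_top
        by (auto elim!: allE[of _ X] eventually_mono)
      then obtain N where "X \<subseteq> P_plus_upto N" by (auto simp: eventually_sequentially)
      then have "sum t X \<le> sum t (P_plus_upto N)"
        by (intro sum_mono2 finite_P_plus_upto nonneg)
      with le show "sum t X \<le> s" using order_trans by blast
    qed
  qed (rule nonneg)
  then have "(t has_sum infsum t P_plus) P_plus" by (rule has_sum_infsum)
  moreover from this have "(\<lambda>N. sum t (P_plus_upto N)) \<longlonglongrightarrow> infsum t P_plus"
    unfolding has_sum_def by (rule filterlim_compose[OF _ P_plus_upto_tendsto])
  ultimately show ?thesis using lim LIMSEQ_unique by blast
qed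

lemma cos_partial_sum_eq_sum_P_plus:
  fixes f :: "real ^ ('n::{finite,linorder}) \<Rightarrow> real"
  assumes sym: "\<And>w x. w permutes UNIV \<Longrightarrow> f (perm_vec w x) = f x" and cont: "continuous_on UNIV f"
  shows "cos_partial_sum f N x = (\<Sum>m\<in>P_plus_upto N.
    2 ^ (2 * CARD('n)) / (2 ^ zeros m * real (card (stabG m))) * cos_coeff f m * cos_plus m x)"
  unfolding cos_partial_sum_def sum_box_upto_eq_sum_P_plus
proof (intro sum.cong refl)
  fix m :: "int ^ ('n::_)"
  have "(\<Sum>w | w permutes UNIV. 2 ^ (2 * CARD('n)) / 2 ^ zeros (perm_vec w m) * cos_coeff f (perm_vec w m)
      * cos_prod (perm_vec w m) x) = 2 ^ (2 * CARD('n)) / 2 ^ zeros m * cos_coeff f m * cos_plus m x"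
    unfolding cos_plus_eq_sum sum_distrib_left
    using sym cont by (intro sum.cong) (auto simp: zeros_perm_vec cos_coeff_perm_vec)
  then show "(\<Sum>w | w permutes UNIV. 2 ^ (2 * CARD('n)) / 2 ^ zeros (perm_vec w m)
      * cos_coeff f (perm_vec w m) * cos_prod (perm_vec w m) x) / real (card (stabG m))
    = 2 ^ (2 * CARD('n)) / (2 ^ zeros m * real (card (stabG m))) * cos_coeff f m * cos_plus m x"
    by simp
qed

text \<open>Pairing \<open>f\<close> with its own partial sum makes each inner integral a
  coefficient by definition, so the squares appear at once.\<close>

lemma integral_mult_cos_partial_sum:
  fixes f :: "real ^ ('n::finite) \<Rightarrow> real"
  assumes cont: "continuous_on UNIV f"
  shows "(LINT x:half_cube|lborel. f x * cos_partial_sum f N x)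
    = (\<Sum>k\<in>box_upto N. 2 ^ (2 * CARD('n)) / 2 ^ zeros k * (cos_coeff f k)\<^sup>2)"
proof -
  let ?c = "\<lambda>k. 2 ^ (2 * CARD('n)) / 2 ^ zeros k * cos_coeff f k"
  have "(LINT x:half_cube|lborel. f x * cos_partial_sum f N x)
      = (LINT x:half_cube|lborel. (\<Sum>k\<in>box_upto N. ?c k * (f x * cos_prod k x)))"
    by (simp add: cos_partial_sum_def sum_distrib_left mult_ac)
  also have "\<dots> = (\<Sum>k\<in>box_upto N. LINT x:half_cube|lborel. ?c k * (f x * cos_prod k x))"
    by (intro set_lebesgue_integral_sum set_integrable_half_cube continuous_intros cont)
  also have "\<dots> = (\<Sum>k\<in>box_upto N. ?c k * cos_coeff f k)"
    by (simp add: cos_coeff_def)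
  finally show ?thesis by (simp add: power2_eq_square mult_ac)
qed

lemma sum_box_upto_symmetric:
  fixes G :: "int ^ ('n::{finite,linorder}) \<Rightarrow> real"
  assumes "\<And>w m. w permutes UNIV \<Longrightarrow> G (perm_vec w m) = G m"
  shows "sum G (box_upto N) = fact CARD('n) * (\<Sum>m\<in>P_plus_upto N. G m / real (card (stabG m)))"
  unfolding sum_box_upto_eq_sum_P_plus
  using assms card_permutations[of "UNIV :: 'n set"] by (simp add: sum_distrib_left)

text \<open>Reindexing the sum by \<open>u \<circ> w\<close> lets \<open>w\<close> act on weight and
  point together, where it only reorders the factors.\<close>

lemma cos_plus_perm_vec:
  assumes w: "w permutes UNIV"
  shows "cos_plus m (perm_vec w x) = cos_plus m x"
proof -
  have "cos_prod (perm_vec (u \<circ> w) m) (perm_vec w x) = cos_prod (perm_vec u m) x" for u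
    by (simp add: perm_vec_comp cos_prod_perm_vec[OF w])
  then show ?thesis
    unfolding cos_plus_eq_sum
    by (subst sum_permutations_compose_right[OF w]) simp
qed

text \<open>The n! equal terms of \<open>cos_plus\<close> cancel the n! tiles of the half cube.
  Hence a symmetrised coefficient on the fundamental domain is an ordinary cosine coefficient on the
  half cube.\<close>

lemma integral_closure_fundF_cos_plus:
  fixes f :: "real ^ ('n::{finite,linorder}) \<Rightarrow> real"
  assumes sym: "\<And>w x. w permutes UNIV \<Longrightarrow> f (perm_vec w x) = f x"
    and cont: "continuous_on UNIV f"
  shows "(LINT x:closure fundF|lborel. f x * cos_plus m x) = cos_coeff f m"
proof -
  have "continuous_on UNIV (\<lambda>x. f x * cos_plus m x)"
    unfolding cos_plus_eq_sum by (intro continuous_intros cont)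
  then have "(LINT x:half_cube|lborel. f x * cos_plus m x)
      = fact CARD('n) * (LINT x:closure fundF|lborel. f x * cos_plus m x)"
    by (intro integral_closure_fundF set_integrable_half_cube borel_measurable_continuous_onI)
      (simp_all add: sym cos_plus_perm_vec)
  then show ?thesis by (simp add: integral_half_cube_cos_plus[OF sym cont])
qed

text \<open>The error is uniform on a set of finite volume \<open>V\<close> and \<open>f\<close> is
  bounded by \<open>b\<close>, so the integrals differ by at most
  \<open>b * e N * V\<close>.\<close>

lemma integral_mult_cos_partial_sum_tendsto:
  fixes f :: "real ^ ('n::finite) \<Rightarrow> real"
  assumes cont: "continuous_on UNIV f" and b: "\<And>x. \<bar>f x\<bar> \<le> b"
    and error: "\<And>x N. x \<in> half_cube \<Longrightarrow> 0 < N \<Longrightarrow> \<bar>f x - cos_partial_sum f N x\<bar> \<le> e N"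
    and e: "e \<longlonglongrightarrow> 0"
  shows "(\<lambda>N. LINT x:half_cube|lborel. f x * cos_partial_sum f N x)
    \<longlonglongrightarrow> (LINT x:half_cube|lborel. (f x)\<^sup>2)"
proof -
  define V where "V = (LINT x:(half_cube :: (real ^ 'n) set)|lborel. (1::real))"
  have cont_S: "continuous_on UNIV (cos_partial_sum f N)" for N
    unfolding cos_partial_sum_def by (intro continuous_intros)
  have le: "\<bar>(LINT x:half_cube|lborel. f x * cos_partial_sum f N x) - (LINT x:half_cube|lborel. (f x)\<^sup>2)\<bar>
      \<le> b * e N * V" if N: "0 < N" for N
  proof -
    let ?d = "\<lambda>x. f x * cos_partial_sum f N x - (f x)\<^sup>2"
    have int: "set_integrable lborel half_cube ?d"
      by (intro set_integrable_half_cube continuous_intros cont cont_S)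
    have "(LINT x:half_cube|lborel. f x * cos_partial_sum f N x) - (LINT x:half_cube|lborel. (f x)\<^sup>2)
        = (LINT x:half_cube|lborel. ?d x)"
      by (intro set_integral_diff(2)[symmetric] set_integrable_half_cube continuous_intros cont cont_S)
    also have "\<bar>\<dots>\<bar> \<le> (LINT x:half_cube|lborel. norm (?d x))"
      using set_integral_norm_bound[OF int] by simp
    also have "\<dots> \<le> (LINT x:(half_cube :: (real ^ 'n) set)|lborel. b * e N * 1)"
    proof (rule set_integral_mono)
      show "set_integrable lborel half_cube (\<lambda>x. norm (?d x))"
        by (intro set_integrable_half_cube continuous_intros cont cont_S)
      show "set_integrable lborel half_cube (\<lambda>x. b * e N * 1)"
        by (intro set_integrable_half_cube continuous_intros)
      fix x :: "real ^ 'n" assume x: "x \<in> half_cube"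
      have "?d x = f x * (cos_partial_sum f N x - f x)"
        by (simp add: power2_eq_square right_diff_distrib)
      then have "norm (?d x) = \<bar>f x\<bar> * \<bar>f x - cos_partial_sum f N x\<bar>"
        by (simp add: abs_mult abs_minus_commute)
      also have "\<dots> \<le> b * e N"
        using b[of x] error[OF x N] by (intro mult_mono) auto
      finally show "norm (?d x) \<le> b * e N * 1" by simp
    qed
    also have "\<dots> = b * e N * V" unfolding V_def by (rule set_integral_mult_right)
    finally show ?thesis .
  qed
  have "(\<lambda>N. b * e N * V) \<longlonglongrightarrow> b * 0 * V" by (intro tendsto_intros e)
  then have lim: "(\<lambda>N. b * e N * V) \<longlonglongrightarrow> 0" by simp
  show ?thesis
  proof (rule LIM_zero_cancel, rule Lim_null_comparison[OF _ lim])
    show "\<forall>\<^sub>F N in sequentially. norm ((LINT x:half_cube|lborel. f x * cos_partial_sum f N x)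
        - (LINT x:half_cube|lborel. (f x)\<^sup>2)) \<le> b * e N * V"
      using le by (intro eventually_sequentiallyI[of 1]) simp
  qed
qed

section \<open>The expansion and the Plancherel formula\<close>

theorem mainTheorem8:
  fixes f :: "real ^ ('n::{finite,linorder}) \<Rightarrow> real"
    and c :: "int ^ ('n::{finite,linorder}) \<Rightarrow> real"
  assumes "continuous_on UNIV f"
    and "continuous_partials f"
    and "\<And>x w r. w permutes UNIV \<Longrightarrow> f (perm_vec w x + int_vec r) = f x"
    and "\<And>x i. f (sign_flip i x) = f x"
    and "\<And>m. m \<in> P_plus \<Longrightarrow>
      c m = 2 ^ (2 * CARD('n)) / (2 ^ zeros m * real (card (stabG m)))
              * (LINT x:closure fundF|lborel. f x * cos_plus m x)"
  shows "(\<forall>x\<in>fundF. (\<lambda>N. \<Sum>m\<in>P_plus_upto N. c m * cos_plus m x) \<longlonglongrightarrow> f x)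
    \<and> ((\<lambda>m. 2 ^ zeros m * real (card (stabG m)) * \<bar>c m\<bar>\<^sup>2) has_sum
           (2 ^ (2 * CARD('n)) * (LINT x:closure fundF|lborel. \<bar>f x\<bar>\<^sup>2))) P_plus"
proof
  have sym: "f (perm_vec w x) = f x" if "w permutes UNIV" for w x
  proof -
    have "int_vec 0 = (0 :: real ^ ('n::_))" by (simp add: int_vec_def vec_eq_iff)
    then show ?thesis using assms(3)[OF that, of x 0] by simp
  qed
  have per: "f (x + int_vec r) = f x" for x r
    using assms(3)[OF permutes_id, of x r] by simp
  obtain b where b: "\<And>x. \<bar>f x\<bar> \<le> b"
    using bounded_if_periodic[OF assms(1) per] by blast
  have "\<forall>i. \<exists>g. continuous_on UNIV g \<and>
      (\<forall>x. ((\<lambda>t. f (x + t *\<^sub>R axis i 1)) has_real_derivative g x) (at 0))"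
    using assms(2) by (simp add: continuous_partials_def)
  then obtain g where g_cont: "\<And>i. continuous_on UNIV (g i)"
    and deriv: "\<And>i x. ((\<lambda>t. f (x + t *\<^sub>R axis i 1)) has_real_derivative g i x) (at 0)"
    by metis
  \<comment> \<open>Derivatives are unique, so the partial derivatives inherit the periods of
    \<open>f\<close>; continuity alone would not bound them on the whole space.\<close>
  have g_per: "g i (x + int_vec r) = g i x" for i x r
  proof -
    have "x + int_vec r + t *\<^sub>R axis i 1 = (x + t *\<^sub>R axis i 1) + int_vec r" for t by simp
    then have "(\<lambda>t. f (x + int_vec r + t *\<^sub>R axis i 1)) = (\<lambda>t. f (x + t *\<^sub>R axis i 1))"
      using per by metis
    then show ?thesis using deriv[of "x + int_vec r" i] deriv[of x i] DERIV_unique by metis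
  qed
  have "\<exists>B. \<forall>x. \<bar>g i x\<bar> \<le> B" for i
    using bounded_if_periodic[OF g_cont g_per] by metis
  then obtain B' where B': "\<And>i x. \<bar>g i x\<bar> \<le> B' i" by metis
  define B where "B = Max (range B')"
  have g_bound: "\<bar>g i x\<bar> \<le> B" for i x
  proof -
    have "B' i \<le> B" unfolding B_def by (intro Max_ge) auto
    with B'[of i x] show ?thesis by linarith
  qed
  have error: "\<bar>f x - cos_partial_sum f N x\<bar> \<le> cos_error CARD('n) B N" if "x \<in> half_cube" "0 < N" for x N
    using assms(1) b g_cont g_bound deriv that by (rule cos_partial_sum_error)
  have c_eq: "c m = 2 ^ (2 * CARD('n)) / (2 ^ zeros m * real (card (stabG m))) * cos_coeff f m"
    if "m \<in> P_plus" for m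
    using assms(5)[OF that] integral_closure_fundF_cos_plus[OF sym assms(1)] by simp
  have partial_sum: "(\<Sum>m\<in>P_plus_upto N. c m * cos_plus m x) = cos_partial_sum f N x" for N x
  proof -
    have "cos_partial_sum f N x = (\<Sum>m\<in>P_plus_upto N.
        2 ^ (2 * CARD('n)) / (2 ^ zeros m * real (card (stabG m))) * cos_coeff f m * cos_plus m x)"
      using sym assms(1) by (rule cos_partial_sum_eq_sum_P_plus)
    also have "\<dots> = (\<Sum>m\<in>P_plus_upto N. c m * cos_plus m x)"
      by (intro sum.cong refl) (simp add: c_eq P_plus_upto_def)
    finally show ?thesis by simp
  qed

  show "\<forall>x\<in>fundF. (\<lambda>N. \<Sum>m\<in>P_plus_upto N. c m * cos_plus m x) \<longlonglongrightarrow> f x"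
  proof
    fix x :: "real ^ ('n::_)" assume "x \<in> fundF"
    then have "x \<in> half_cube" by (auto simp: fundF_def half_cube_def less_imp_le)
    then have "\<forall>\<^sub>F N in sequentially. norm (cos_partial_sum f N x - f x) \<le> cos_error CARD('n) B N"
      by (intro eventually_sequentiallyI[of 1]) (use error[of x] in \<open>simp add: abs_minus_commute\<close>)
    then have "(\<lambda>N. cos_partial_sum f N x - f x) \<longlonglongrightarrow> 0"
      using cos_error_tendsto_0 by (rule Lim_null_comparison)
    then show "(\<lambda>N. \<Sum>m\<in>P_plus_upto N. c m * cos_plus m x) \<longlonglongrightarrow> f x"
      unfolding partial_sum by (rule LIM_zero_cancel)
  qed

  let ?t = "\<lambda>m. 2 ^ zeros m * real (card (stabG m)) * \<bar>c m\<bar>\<^sup>2"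
  let ?I = "\<lambda>N. LINT x:half_cube|lborel. f x * cos_partial_sum f N x"
  have "(\<lambda>N. ?I N) \<longlonglongrightarrow> (LINT x:half_cube|lborel. (f x)\<^sup>2)"
    using assms(1) b error cos_error_tendsto_0 by (rule integral_mult_cos_partial_sum_tendsto)
  also have "(LINT x:half_cube|lborel. (f x)\<^sup>2) = fact CARD('n) * (LINT x:closure fundF|lborel. (f x)\<^sup>2)"
    using assms(1) by (intro integral_closure_fundF set_integrable_half_cube
        borel_measurable_continuous_onI continuous_intros) (simp add: sym)
  finally have lim: "?I \<longlonglongrightarrow> fact CARD('n) * (LINT x:closure fundF|lborel. (f x)\<^sup>2)" .
  have "sum ?t (P_plus_upto N) = 2 ^ (2 * CARD('n)) / fact CARD('n) * ?I N" for N
  proof -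
    let ?G = "\<lambda>k. 2 ^ (2 * CARD('n)) / 2 ^ zeros k * (cos_coeff f k)\<^sup>2"
    have "?I N = fact CARD('n) * (\<Sum>m\<in>P_plus_upto N. ?G m / real (card (stabG m)))"
      unfolding integral_mult_cos_partial_sum[OF assms(1)]
      by (rule sum_box_upto_symmetric) (simp add: zeros_perm_vec cos_coeff_perm_vec sym assms(1))
    \<comment> \<open>Squaring \<open>c m\<close> squares its normalising factor
      \<open>2 ^ (2 * CARD('n)) / (2 ^ zeros m * real (card (stabG m)))\<close>. The weight in
      \<open>?t\<close> cancels one denominator, and one power \<open>2 ^ (2 * CARD('n))\<close> is
      left as the Plancherel constant.\<close>
    moreover have "?t m = 2 ^ (2 * CARD('n)) * (?G m / real (card (stabG m)))" if "m \<in> P_plus_upto N" for m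
    proof -
      have "m \<in> P_plus" using that by (simp add: P_plus_upto_def)
      moreover have "real (card (stabG m)) \<noteq> 0" using card_stabG_pos[of m] by linarith
      ultimately show ?thesis
        by (simp add: c_eq power_divide power_mult_distrib field_simps power2_eq_square)
    qed
    ultimately show ?thesis by (simp add: sum_distrib_left)
  qed
  moreover have "(\<lambda>N. 2 ^ (2 * CARD('n)) / fact CARD('n) * ?I N)
      \<longlonglongrightarrow> 2 ^ (2 * CARD('n)) / fact CARD('n) * (fact CARD('n) * (LINT x:closure fundF|lborel. (f x)\<^sup>2))"
    by (intro tendsto_intros lim)
  ultimately have "(\<lambda>N. sum ?t (P_plus_upto N))
      \<longlonglongrightarrow> 2 ^ (2 * CARD('n)) * (LINT x:closure fundF|lborel. \<bar>f x\<bar>\<^sup>2)" by simp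
  then show "(?t has_sum (2 ^ (2 * CARD('n)) * (LINT x:closure fundF|lborel. \<bar>f x\<bar>\<^sup>2))) P_plus"
    by (intro has_sum_P_plus) simp
qed

end
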